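(* Given a finite set $M$, a set $\mathcal{Q}\subseteq\mathcal{P}(M)$ and a relation $\mathcal{R}\subseteq\mathcal{Q}\times\mathcal{Q}$, there is an algorithm running in time $O(|M|+|\mathcal{R}|+\sum_{A\in\mathcal{Q}}|A|)$ that returns a linear ordering $\sigma$ of $M$ fulfilling the one-before-all property if such an ordering exists, and reports that none exists otherwise.
   Context: A linear ordering $\sigma$ of $M$ fulfills the one-before-all property (with respect to $\mathcal{Q},\mathcal{R}$) if for all $A,B\in\mathcal Q$ with $(A,B)\in\mathcal R$ and $B\neq\emptyset$ there is an $x\in A$ such that $x\prec_\sigma y$ for all $y\in B$. *)

theory Defs
  imports "HOL-Library.Landau_Symbols"
begin

section \<open>The one-before-all property\<close>

text \<open>A linear ordering of \<open>M\<close> is a reflexive \<^const>\<open>linear_order_on\<close> \<open>M\<close>; the strict relation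
  \<open>x \<prec> y\<close> is \<open>(x, y) \<in> \<sigma> \<and> x \<noteq> y\<close>.\<close>

definition one_before_all :: "'a set set \<Rightarrow> ('a set \<times> 'a set) set \<Rightarrow> 'a rel \<Rightarrow> bool" where
  "one_before_all Q R \<sigma> \<longleftrightarrow>
    (\<forall>A\<in>Q. \<forall>B\<in>Q. (A, B) \<in> R \<and> B \<noteq> {} \<longrightarrow> (\<exists>x\<in>A. \<forall>y\<in>B. (x, y) \<in> \<sigma> \<and> x \<noteq> y))"


section \<open>The machine model\<close>

text \<open>
  A unit-cost random access machine with structured control flow, working on natural numbers.
  It has registers and zero-based arrays, both named by natural numbers; a program mentions only
  finitely many of them.

  The only arithmetic is adding and subtracting one.  A stored value therefore exceeds the
  constants of the program and the values of the input by at most the number of steps made, so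
  unit cost is not a way to hide computations with long numbers: a program whose running time is
  polynomial uses words of logarithmic length only.  Everything here takes constant time on the
  usual RAM with addition, so time bounds carry over to it.
\<close>

datatype com =
    Skip
  | Const nat nat            \<comment> \<open>\<open>x := n\<close>\<close>
  | Copy nat nat             \<comment> \<open>\<open>x := y\<close>\<close>
  | Inc nat                  \<comment> \<open>\<open>x := x + 1\<close>\<close>
  | Dec nat                  \<comment> \<open>\<open>x := x - 1\<close>, truncated at \<open>0\<close>\<close>
  | Load nat nat nat         \<comment> \<open>\<open>x := a[y]\<close>\<close>
  | Store nat nat nat        \<comment> \<open>\<open>a[x] := y\<close>\<close>
  | Seq com com
  | IfLess nat nat com com   \<comment> \<open>\<open>if x < y then \<dots> else \<dots>\<close>\<close>
  | WhileLess nat nat com    \<comment> \<open>\<open>while x < y do \<dots>\<close>\<close>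

record state =
  reg :: "nat \<Rightarrow> nat"
  arr :: "nat \<Rightarrow> nat \<Rightarrow> nat"

text \<open>\<open>exec c s t s'\<close>: started in \<open>s\<close>, the program \<open>c\<close> halts in \<open>s'\<close> after exactly \<open>t\<close> steps.
  Every elementary command and every evaluation of a test is one step.\<close>

inductive exec :: "com \<Rightarrow> state \<Rightarrow> nat \<Rightarrow> state \<Rightarrow> bool" where
  Skip: "exec Skip s 1 s"
| Const: "exec (Const x n) s 1 (s\<lparr>reg := (reg s)(x := n)\<rparr>)"
| Copy: "exec (Copy x y) s 1 (s\<lparr>reg := (reg s)(x := reg s y)\<rparr>)"
| Inc: "exec (Inc x) s 1 (s\<lparr>reg := (reg s)(x := reg s x + 1)\<rparr>)"
| Dec: "exec (Dec x) s 1 (s\<lparr>reg := (reg s)(x := reg s x - 1)\<rparr>)"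
| Load: "exec (Load x a y) s 1 (s\<lparr>reg := (reg s)(x := arr s a (reg s y))\<rparr>)"
| Store: "exec (Store a x y) s 1
    (s\<lparr>arr := (arr s)(a := (arr s a)(reg s x := reg s y))\<rparr>)"
| Seq: "exec c\<^sub>1 s t\<^sub>1 s' \<Longrightarrow> exec c\<^sub>2 s' t\<^sub>2 s'' \<Longrightarrow> exec (Seq c\<^sub>1 c\<^sub>2) s (t\<^sub>1 + t\<^sub>2) s''"
| IfTrue: "reg s x < reg s y \<Longrightarrow> exec c\<^sub>1 s t s' \<Longrightarrow> exec (IfLess x y c\<^sub>1 c\<^sub>2) s (t + 1) s'"
| IfFalse: "\<not> reg s x < reg s y \<Longrightarrow> exec c\<^sub>2 s t s' \<Longrightarrow> exec (IfLess x y c\<^sub>1 c\<^sub>2) s (t + 1) s'"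
| WhileFalse: "\<not> reg s x < reg s y \<Longrightarrow> exec (WhileLess x y c) s 1 s"
| WhileTrue: "reg s x < reg s y \<Longrightarrow> exec c s t\<^sub>1 s' \<Longrightarrow> exec (WhileLess x y c) s' t\<^sub>2 s'' \<Longrightarrow>
    exec (WhileLess x y c) s (t\<^sub>1 + t\<^sub>2 + 1) s''"

inductive_cases exec_SkipE: "exec Skip s t s'"
  and exec_ConstE: "exec (Const x n) s t s'"
  and exec_CopyE: "exec (Copy x y) s t s'"
  and exec_IncE: "exec (Inc x) s t s'"
  and exec_DecE: "exec (Dec x) s t s'"
  and exec_LoadE: "exec (Load x a y) s t s'"
  and exec_StoreE: "exec (Store a x y) s t s'"
  and exec_SeqE: "exec (Seq c\<^sub>1 c\<^sub>2) s t s'"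
  and exec_IfLessE: "exec (IfLess x y c\<^sub>1 c\<^sub>2) s t s'"
  and exec_WhileLessE: "exec (WhileLess x y c) s t s'"

lemma exec_deterministic:
  "exec c s t s' \<Longrightarrow> exec c s u s'' \<Longrightarrow> u = t \<and> s'' = s'"
proof (induction arbitrary: u s'' rule: exec.induct)
  case (Seq c\<^sub>1 s t\<^sub>1 s' c\<^sub>2 t\<^sub>2 s'' u s''a)
  from Seq.prems obtain u\<^sub>1 v u\<^sub>2 where u: "u = u\<^sub>1 + u\<^sub>2"
    and 1: "exec c\<^sub>1 s u\<^sub>1 v" and 2: "exec c\<^sub>2 v u\<^sub>2 s''a"
    by (rule exec_SeqE)
  from Seq.IH(1)[OF 1] 2 have "exec c\<^sub>2 s' u\<^sub>2 s''a" "u\<^sub>1 = t\<^sub>1" by simp_all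
  with Seq.IH(2) u show ?case by simp
next
  case (IfTrue s x y c\<^sub>1 t s' c\<^sub>2 u s''a)
  from IfTrue.prems IfTrue.hyps(1) obtain u' where u: "u = Suc u'"
    and 1: "exec c\<^sub>1 s u' s''a"
    by (elim exec_IfLessE) simp_all
  from IfTrue.IH[OF 1] u show ?case by simp
next
  case (IfFalse s x y c\<^sub>2 t s' c\<^sub>1 u s''a)
  from IfFalse.prems IfFalse.hyps(1) obtain u' where u: "u = Suc u'"
    and 1: "exec c\<^sub>2 s u' s''a"
    by (elim exec_IfLessE) simp_all
  from IfFalse.IH[OF 1] u show ?case by simp
next
  case (WhileFalse s x y c)
  from WhileFalse.prems show ?case
    by (rule exec_WhileLessE) (use WhileFalse.hyps in simp_all)
next
  case (WhileTrue s x y c t\<^sub>1 s' t\<^sub>2 s'' u s''a)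
  from WhileTrue.prems obtain u\<^sub>1 v u\<^sub>2 where u: "u = Suc (u\<^sub>1 + u\<^sub>2)"
    and 1: "exec c s u\<^sub>1 v" and 2: "exec (WhileLess x y c) v u\<^sub>2 s''a"
    by (rule exec_WhileLessE) (use WhileTrue.hyps(1) in simp, rule that)
  from WhileTrue.IH(1)[OF 1] 2 have "exec (WhileLess x y c) s' u\<^sub>2 s''a" "u\<^sub>1 = t\<^sub>1" by simp_all
  with WhileTrue.IH(2) u show ?case by simp
qed (auto elim: exec_SkipE exec_ConstE exec_CopyE exec_IncE exec_DecE exec_LoadE exec_StoreE)


section \<open>Input and output\<close>

text \<open>
  The elements of \<open>M\<close> and the members of \<open>Q\<close> are numbered consecutively, in an arbitrary order:
  \<open>ms\<close> lists \<open>M\<close>, \<open>qs\<close> lists the members of \<open>Q\<close>, each as a list of indices into \<open>ms\<close>, and \<open>rs\<close>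
  lists the pairs in \<open>R\<close>, each as a pair of indices into \<open>qs\<close>.  None of the lists has repetitions,
  neither have the sets named by \<open>qs\<close>.
\<close>

definition encodes ::
    "'a list \<Rightarrow> nat list list \<Rightarrow> (nat \<times> nat) list \<Rightarrow>
     'a set \<Rightarrow> 'a set set \<Rightarrow> ('a set \<times> 'a set) set \<Rightarrow> bool" where
  "encodes ms qs rs M Q R \<longleftrightarrow>
    distinct ms \<and> set ms = M \<and>
    (\<forall>q\<in>set qs. distinct q \<and> set q \<subseteq> {..<length ms}) \<and>
    (let S = map (\<lambda>q. (!) ms ` set q) qs in
      distinct S \<and> set S = Q \<and>
      distinct rs \<and> set rs \<subseteq> {..<length qs} \<times> {..<length qs} \<and>
      (\<lambda>(i, j). (S ! i, S ! j)) ` set rs = R)"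

definition array_of :: "nat list \<Rightarrow> nat \<Rightarrow> nat" where
  "array_of xs i = (if i < length xs then xs ! i else 0)"

text \<open>
  The machine sees indices only.  Initially, registers \<open>0\<close>, \<open>1\<close>, \<open>2\<close> hold \<open>|M|\<close>, \<open>|Q|\<close>, \<open>|R|\<close>.
  Array \<open>0\<close> is the concatenation of the members of \<open>Q\<close>; the \<open>i\<close>-th one occupies the cells from
  entry \<open>i\<close> of array \<open>1\<close> up to, excluding, entry \<open>i + 1\<close> of array \<open>1\<close>.  Arrays \<open>2\<close> and \<open>3\<close> hold the
  components of the pairs in \<open>R\<close>.  Everything else is zero.
\<close>

definition initial_state :: "'a list \<Rightarrow> nat list list \<Rightarrow> (nat \<times> nat) list \<Rightarrow> state" where
  "initial_state ms qs rs =
    \<lparr>reg = (\<lambda>_. 0)(0 := length ms, 1 := length qs, 2 := length rs),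
     arr = (\<lambda>_ _. 0)
       (0 := array_of (concat qs),
        1 := array_of (map (\<lambda>i. length (concat (take i qs))) [0..<length qs + 1]),
        2 := array_of (map fst rs),
        3 := array_of (map snd rs))\<rparr>"

text \<open>At the end, register \<open>3\<close> is the verdict.  If it is \<open>1\<close>, the first \<open>|M|\<close> cells of array \<open>4\<close>
  list the indices of the elements of \<open>M\<close> in ascending order with respect to the ordering
  returned; if it is \<open>0\<close>, the nonexistence of an ordering is reported.\<close>

definition returns_order :: "'a list \<Rightarrow> state \<Rightarrow> 'a rel \<Rightarrow> bool" where
  "returns_order ms s \<sigma> \<longleftrightarrow>
    reg s 3 = 1 \<and>
    bij_betw (arr s 4) {..<length ms} {..<length ms} \<and>
    \<sigma> = {(ms ! arr s 4 i, ms ! arr s 4 j) | i j. i \<le> j \<and> j < length ms}"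

definition reports_none :: "state \<Rightarrow> bool" where
  "reports_none s \<longleftrightarrow> reg s 3 = 0"

text \<open>Every instance has an encoding.\<close>

lemma encodes_exists:
  fixes M :: "'a set"
  assumes M: "finite M" and Q: "Q \<subseteq> Pow M" and R: "R \<subseteq> Q \<times> Q"
  shows "\<exists>ms qs rs. encodes ms qs rs M Q R"
proof -
  obtain ms where ms: "set ms = M" "distinct ms"
    using M finite_distinct_list by blast
  have fQ: "finite Q" using Q M by (meson finite_Pow_iff finite_subset)
  then obtain S where S: "set S = Q" "distinct S"
    using finite_distinct_list by blast
  define code where "code = (\<lambda>A. sorted_list_of_set {i. i < length ms \<and> ms ! i \<in> A})"
  define qs where "qs = map code S"
  have code: "(!) ms ` set (code A) = A" if "A \<in> Q" for A
  proof -
    have "A \<subseteq> set ms" using that Q ms by auto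
    moreover have "set (code A) = {i. i < length ms \<and> ms ! i \<in> A}"
      by (simp add: code_def)
    ultimately show ?thesis
      by (fastforce simp: in_set_conv_nth)
  qed
  have S_eq: "map (\<lambda>q. (!) ms ` set q) qs = S"
    unfolding qs_def map_map o_def by (rule map_idI) (simp add: S(1) code)
  define I where "I = {(i, j). i < length S \<and> j < length S \<and> (S ! i, S ! j) \<in> R}"
  have "finite I"
    by (rule finite_subset[of _ "{..<length S} \<times> {..<length S}"]) (auto simp: I_def)
  then obtain rs where rs: "set rs = I" "distinct rs"
    using finite_distinct_list by blast
  have R_eq: "(\<lambda>(i, j). (S ! i, S ! j)) ` I = R"
  proof
    show "R \<subseteq> (\<lambda>(i, j). (S ! i, S ! j)) ` I"
    proof
      fix z assume z: "z \<in> R"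
      obtain A B where AB: "z = (A, B)" by (cases z)
      with z R S have "A \<in> set S" "B \<in> set S" by auto
      then obtain i j where "i < length S" "S ! i = A" "j < length S" "S ! j = B"
        by (metis in_set_conv_nth)
      with AB z show "z \<in> (\<lambda>(i, j). (S ! i, S ! j)) ` I"
        by (auto simp: I_def image_iff intro!: bexI[of _ "(i, j)"])
    qed
  qed (auto simp: I_def)
  have "encodes ms qs rs M Q R"
    unfolding encodes_def Let_def S_eq
    using ms S rs R_eq by (auto simp: qs_def code_def I_def)
  then show ?thesis by blast
qed

end

theory Submission
  imports Defs
begin

text \<open>
  An ordering has the property iff every member \<open>y\<close> of a nonempty set \<open>B\<close> is preceded by some
  element of each \<open>A\<close> with \<open>(A, B) \<in> R\<close>: for the first \<open>y\<close> in \<open>B\<close> this yields one \<open>x \<in> A\<close>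
  before all of \<open>B\<close>.  So an element may be placed greedily as soon as, for each set \<open>B\<close> containing
  it, each such \<open>A\<close> has an element placed already.  If the greedy procedure gets stuck, the least
  unplaced element with respect to an ordering with the property would be available, so none exists.
  The availability of elements is propagated by counters through an and/or graph with
  \<open>|M| + 2 |Q|\<close> nodes and \<open>|R| + 2 (\<Sum>A\<in>Q. |A|)\<close> edges; at most one member of \<open>Q\<close> is empty, so
  \<open>|Q|\<close> is within the bound.
\<close>


section \<open>Weakest preconditions with elapsed time\<close>

text \<open>Because \<open>exec\<close> is deterministic, a halting run is the only run, so this is
  total correctness. The postcondition receives the step count, so time and effect are proved
  together.\<close>

definition wp :: "com \<Rightarrow> (nat \<Rightarrow> state \<Rightarrow> bool) \<Rightarrow> state \<Rightarrow> bool" where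
  "wp c Q s \<longleftrightarrow> (\<exists>t s'. exec c s t s' \<and> Q t s')"

lemma wp_mono: "wp c P s \<Longrightarrow> (\<And>t s'. P t s' \<Longrightarrow> Q t s') \<Longrightarrow> wp c Q s"
  unfolding wp_def by blast

lemma wp_simps [simp]:
  "wp Skip Q s \<longleftrightarrow> Q 1 s"
  "wp (Const x n) Q s \<longleftrightarrow> Q 1 (s\<lparr>reg := (reg s)(x := n)\<rparr>)"
  "wp (Copy x y) Q s \<longleftrightarrow> Q 1 (s\<lparr>reg := (reg s)(x := reg s y)\<rparr>)"
  "wp (Inc x) Q s \<longleftrightarrow> Q 1 (s\<lparr>reg := (reg s)(x := reg s x + 1)\<rparr>)"
  "wp (Dec x) Q s \<longleftrightarrow> Q 1 (s\<lparr>reg := (reg s)(x := reg s x - 1)\<rparr>)"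
  "wp (Load x a y) Q s \<longleftrightarrow> Q 1 (s\<lparr>reg := (reg s)(x := arr s a (reg s y))\<rparr>)"
  "wp (Store a x y) Q s \<longleftrightarrow>
     Q 1 (s\<lparr>arr := (arr s)(a := (arr s a)(reg s x := reg s y))\<rparr>)"
  by (auto simp: wp_def intro: exec.intros
      elim: exec_SkipE exec_ConstE exec_CopyE exec_IncE exec_DecE exec_LoadE exec_StoreE)
    (fastforce intro: exec.intros
      elim: exec_SkipE exec_ConstE exec_CopyE exec_IncE exec_DecE exec_LoadE exec_StoreE)+

lemma wp_Seq [simp]:
  "wp (Seq c\<^sub>1 c\<^sub>2) Q s \<longleftrightarrow> wp c\<^sub>1 (\<lambda>t. wp c\<^sub>2 (\<lambda>t'. Q (t + t'))) s"
  unfolding wp_def by (blast intro: exec.Seq elim: exec_SeqE)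

lemma exec_IfLess_iff:
  "exec (IfLess x y c\<^sub>1 c\<^sub>2) s t s' \<longleftrightarrow>
     (\<exists>u. t = u + 1 \<and> exec (if reg s x < reg s y then c\<^sub>1 else c\<^sub>2) s u s')"
proof
  show "exec (IfLess x y c\<^sub>1 c\<^sub>2) s t s'"
    if "\<exists>u. t = u + 1 \<and> exec (if reg s x < reg s y then c\<^sub>1 else c\<^sub>2) s u s'"
    using that exec.IfTrue[of s x y c\<^sub>1 _ s' c\<^sub>2] exec.IfFalse[of s x y c\<^sub>2 _ s' c\<^sub>1]
    by (auto split: if_splits)
qed (auto elim: exec_IfLessE)

lemma wp_IfLess [simp]:
  "wp (IfLess x y c\<^sub>1 c\<^sub>2) Q s \<longleftrightarrow>
     (if reg s x < reg s y then wp c\<^sub>1 (\<lambda>t. Q (t + 1)) s else wp c\<^sub>2 (\<lambda>t. Q (t + 1)) s)"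
  unfolding wp_def exec_IfLess_iff by auto

text \<open>No variant is needed: the time bound \<open>b\<close> in the invariant forces termination.\<close>

lemma wp_WhileLess:
  assumes init: "I 0 s"
    and bound: "\<And>t s. I t s \<Longrightarrow> t \<le> b"
    and step: "\<And>t s. I t s \<Longrightarrow> reg s x < reg s y \<Longrightarrow> wp c (\<lambda>t'. I (t + t' + 1)) s"
    and exit: "\<And>t s. I t s \<Longrightarrow> \<not> reg s x < reg s y \<Longrightarrow> Q (t + 1) s"
  shows "wp (WhileLess x y c) Q s"
proof -
  have "\<exists>t' s'. exec (WhileLess x y c) s t' s' \<and> Q (t + t') s'" if "I t s" for t s
    using that
  proof (induction "b - t" arbitrary: t s rule: less_induct)
    case less
    show ?case
    proof (cases "reg s x < reg s y")
      case True
      from step[OF less.prems True] obtain t\<^sub>1 s\<^sub>1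
        where 1: "exec c s t\<^sub>1 s\<^sub>1" "I (t + t\<^sub>1 + 1) s\<^sub>1"
        unfolding wp_def by blast
      \<comment> \<open>The test alone costs one step, and \<open>bound\<close> at the new state
        keeps the difference from being truncated.\<close>
      have "b - (t + t\<^sub>1 + 1) < b - t"
        using bound[OF 1(2)] by linarith
      from less.hyps[OF this 1(2)] obtain t\<^sub>2 s\<^sub>2
        where 2: "exec (WhileLess x y c) s\<^sub>1 t\<^sub>2 s\<^sub>2" "Q (t + t\<^sub>1 + 1 + t\<^sub>2) s\<^sub>2"
        by blast
      show ?thesis
        using exec.WhileTrue[OF True 1(1) 2(1)] 2(2) by (force simp: ac_simps)
    next
      case False
      then show ?thesis
        using exec.WhileFalse exit[OF less.prems] by blast
    qed
  qed
  from this[OF init] show ?thesis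
    unfolding wp_def by simp
qed


section \<open>Threshold propagation in a graph\<close>

fun chain :: "(nat \<Rightarrow> nat) \<Rightarrow> nat \<Rightarrow> nat list \<Rightarrow> bool" where
  "chain nx e [] \<longleftrightarrow> e = 0"
| "chain nx e (k # ks) \<longleftrightarrow> e = k \<and> 0 < k \<and> chain nx (nx k) ks"

lemma chain_upd: "chain nx e ks \<Longrightarrow> k \<notin> set ks \<Longrightarrow> chain (nx(k := k')) e ks"
  by (induction ks arbitrary: e) auto

text \<open>Edges are numbered from \<open>1\<close>, because \<open>0\<close> ends a linked list.\<close>

definition src :: "(nat \<times> nat) list \<Rightarrow> nat \<Rightarrow> nat" where
  "src es e = fst (es ! (e - 1))"

definition dst :: "(nat \<times> nat) list \<Rightarrow> nat \<Rightarrow> nat" where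
  "dst es e = snd (es ! (e - 1))"

text \<open>Reversed because a new edge is pushed at the head of the list of its source.\<close>

definition adj :: "(nat \<times> nat) list \<Rightarrow> nat \<Rightarrow> nat list" where
  "adj es v = rev (filter (\<lambda>e. src es e = v) [1..<Suc (length es)])"

lemma adj_Nil [simp]: "adj [] v = []"
  by (simp add: adj_def)

lemma set_adj: "set (adj es v) = {e \<in> {1..length es}. src es e = v}"
  by (auto simp: adj_def)

lemma distinct_adj: "distinct (adj es v)"
  by (simp add: adj_def)

lemma adj_snoc:
  "adj (es @ [(a, b)]) v = (if v = a then Suc (length es) # adj es v else adj es v)"
proof -
  have "filter (\<lambda>e. src (es @ [(a, b)]) e = v) [1..<Suc (length es)]
      = filter (\<lambda>e. src es e = v) [1..<Suc (length es)]"
    by (rule filter_cong) (auto simp: src_def nth_append)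
  moreover have "src (es @ [(a, b)]) (Suc (length es)) = a"
    by (simp add: src_def)
  ultimately show ?thesis
    by (simp add: adj_def)
qed

definition adjacency ::
    "(nat \<times> nat) list \<Rightarrow> nat \<Rightarrow> (nat \<Rightarrow> nat) \<Rightarrow> (nat \<Rightarrow> nat) \<Rightarrow> (nat \<Rightarrow> nat) \<Rightarrow> bool" where
  "adjacency es k d hds nx \<longleftrightarrow> k = length es \<and> (\<forall>e\<in>{1..k}. d e = dst es e) \<and>
     (\<forall>v. chain nx (hds v) (adj es v))"

text \<open>The update made by \<open>add_edge\<close>. Cell \<open>Suc k\<close> is fresh: existing
  lists hold only numbers up to \<open>k\<close>, so \<open>chain_upd\<close> keeps them
  intact.\<close>

lemma adjacency_snoc:
  assumes "adjacency es k d hds nx"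
  shows "adjacency (es @ [(a, b)]) (Suc k) (d(Suc k := b)) (hds(a := Suc k))
           (nx(Suc k := hds a))"
proof -
  have k: "k = length es" and d: "\<forall>e\<in>{1..k}. d e = dst es e"
    and ch: "chain nx (hds v) (adj es v)" for v
    using assms by (auto simp: adjacency_def)
  have "chain (nx(Suc k := hds a)) (hds v) (adj es v)" for v
    by (rule chain_upd[OF ch]) (simp add: set_adj k)
  moreover have "(d(Suc k := b)) e = dst (es @ [(a, b)]) e" if "e \<in> {1..Suc k}" for e
  proof (cases "e = Suc k")
    case False
    then have "e - 1 < length es" "e \<in> {1..k}" using that k by auto
    then show ?thesis using d False by (simp add: dst_def nth_append)
  qed (simp add: dst_def k)
  ultimately show ?thesis
    unfolding adjacency_def adj_snoc by (simp add: k)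
qed

section \<open>Counting followed edges and firing nodes\<close>

definition settled :: "(nat \<times> nat) list \<Rightarrow> nat set \<Rightarrow> nat \<Rightarrow> nat" where
  "settled es D v = card {e \<in> D. dst es e = v}"

definition out_edges :: "(nat \<times> nat) list \<Rightarrow> nat set \<Rightarrow> nat set" where
  "out_edges es P = {e \<in> {1..length es}. src es e \<in> P}"

lemma finite_out_edges [simp]: "finite (out_edges es P)"
  by (simp add: out_edges_def)

lemma card_out_edges: "card (out_edges es P) \<le> length es"
proof -
  have "card (out_edges es P) \<le> card {1..length es}"
    by (rule card_mono) (auto simp: out_edges_def)
  then show ?thesis by simp
qed

lemma out_edges_insert: "out_edges es (insert v P) = out_edges es P \<union> set (adj es v)"
  by (auto simp: out_edges_def set_adj)

lemma out_edges_empty [simp]: "out_edges es {} = {}"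
  by (simp add: out_edges_def)

lemma settled_mono: "D \<subseteq> D' \<Longrightarrow> finite D' \<Longrightarrow> settled es D v \<le> settled es D' v"
  unfolding settled_def by (rule card_mono) auto

lemma settled_insert:
  "finite D \<Longrightarrow> e \<notin> D \<Longrightarrow>
    settled es (insert e D) v = (if v = dst es e then Suc (settled es D v) else settled es D v)"
proof -
  assume *: "finite D" "e \<notin> D"
  have "{e' \<in> insert e D. dst es e' = v} =
    (if v = dst es e then insert e {e' \<in> D. dst es e' = v} else {e' \<in> D. dst es e' = v})"
    by auto
  then show ?thesis using * by (simp add: settled_def)
qed

text \<open>A node fires once at least \<open>thr v\<close> of its incoming edges come from
  fired nodes. \<open>q\<close> lists the fired nodes in order, \<open>D\<close> is the set of edges already followed, and
  \<open>c\<close> holds the remaining demands.\<close>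

definition justified :: "(nat \<times> nat) list \<Rightarrow> (nat \<Rightarrow> nat) \<Rightarrow> nat list \<Rightarrow> bool" where
  "justified es thr q \<longleftrightarrow>
     (\<forall>a v b. q = a @ v # b \<longrightarrow> thr v \<le> settled es (out_edges es (set a)) v)"

lemma justified_snoc:
  assumes "justified es thr q" "thr v \<le> settled es (out_edges es (set q)) v"
  shows "justified es thr (q @ [v])"
  unfolding justified_def
proof (intro allI impI)
  fix a w b assume *: "q @ [v] = a @ w # b"
  show "thr w \<le> settled es (out_edges es (set a)) w"
    using * assms by (cases b rule: rev_cases) (auto simp: justified_def)
qed

text \<open>Subtraction is truncated: the counter of a fired node stays at 0 when further edges
  reach it. \<open>D\<close> may contain only part of the edges leaving \<open>q\<close>, as happens
  in the middle of a list traversal.\<close>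

definition propagating ::
    "(nat \<times> nat) list \<Rightarrow> (nat \<Rightarrow> nat) \<Rightarrow> nat \<Rightarrow> nat set \<Rightarrow> nat list \<Rightarrow> (nat \<Rightarrow> nat) \<Rightarrow> bool" where
  "propagating es thr N D q c \<longleftrightarrow>
     (\<forall>v<N. c v = thr v - settled es D v) \<and> distinct q \<and>
     set q = {v. v < N \<and> thr v \<le> settled es D v} \<and>
     justified es thr q \<and> D \<subseteq> out_edges es (set q)"

lemma propagating_start:
  assumes "\<And>v. v < N \<Longrightarrow> c v = thr v"
  shows "propagating es thr N {} (filter (\<lambda>v. thr v = 0) [0..<N]) c"
proof -
  have "thr v = 0" if "filter (\<lambda>v. thr v = 0) [0..<N] = a @ v # b" for a v b
  proof -
    have "v \<in> set (filter (\<lambda>v. thr v = 0) [0..<N])" using that by simp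
    then show ?thesis by simp
  qed
  then have "justified es thr (filter (\<lambda>v. thr v = 0) [0..<N])"
    unfolding justified_def by (metis zero_le)
  then show ?thesis
    using assms by (auto simp: propagating_def settled_def)
qed

text \<open>An edge changes only the count of its target, whose demand was met before, is met
  exactly now, or stays open. Only the middle case extends the queue, so each node enters at most
  once.\<close>

lemma propagating_step:
  assumes p: "propagating es thr N D q c"
    and e: "e \<in> out_edges es (set q)" "e \<notin> D" and w: "w = dst es e" "w < N"
  shows "c w = 0 \<Longrightarrow> propagating es thr N (insert e D) q c"
    and "c w = 1 \<Longrightarrow> propagating es thr N (insert e D) (q @ [w]) (c(w := 0))"
    and "c w > 1 \<Longrightarrow> propagating es thr N (insert e D) q (c(w := c w - 1))"
proof -
  have c: "\<And>v. v < N \<Longrightarrow> c v = thr v - settled es D v" and dq: "distinct q"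
    and sq: "set q = {v. v < N \<and> thr v \<le> settled es D v}"
    and j: "justified es thr q" and D: "D \<subseteq> out_edges es (set q)"
    using p by (auto simp: propagating_def)
  have "finite D" using D by (rule finite_subset) simp
  then have set_ins: "settled es (insert e D) v =
      (if v = w then Suc (settled es D v) else settled es D v)" for v
    using settled_insert e(2) w(1) by simp
  have eD: "insert e D \<subseteq> out_edges es (set q)" using e(1) D by simp
  \<comment> \<open>Covers both cases with an unchanged queue; for \<open>c w = 0\<close> the
    truncated decrement leaves \<open>c\<close> as it is.\<close>
  have stay: "propagating es thr N (insert e D) q c'"
    if "thr w \<noteq> Suc (settled es D w)" "c' = c(w := c w - 1)" for c'
  proof -
    have "\<forall>v<N. c' v = thr v - settled es (insert e D) v"
      using c w(2) by (simp add: that(2) set_ins)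
    moreover have "set q = {v. v < N \<and> thr v \<le> settled es (insert e D) v}"
      using that(1) unfolding sq set_ins by (auto simp: le_Suc_eq)
    ultimately show ?thesis
      using dq j eD unfolding propagating_def by blast
  qed
  show "propagating es thr N (insert e D) q c" if "c w = 0"
    by (rule stay) (use that c[OF w(2)] in \<open>auto simp: fun_eq_iff\<close>)
  show "propagating es thr N (insert e D) q (c(w := c w - 1))" if "c w > 1"
    by (rule stay) (use that c[OF w(2)] in auto)
  show "propagating es thr N (insert e D) (q @ [w]) (c(w := 0))" if "c w = 1"
  proof -
    have thr: "thr w = Suc (settled es D w)" using that c[OF w(2)] by simp
    have wq: "w \<notin> set q" unfolding sq using thr by simp
    have "thr w \<le> settled es (insert e D) w"
      using thr by (simp add: set_ins)
    \<comment> \<open>Justification refers to all edges leaving \<open>q\<close>, a superset of the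
      edges followed so far.\<close>
    also have "\<dots> \<le> settled es (out_edges es (set q)) w"
      by (rule settled_mono[OF eD]) simp
    finally have "justified es thr (q @ [w])"
      using j by (rule justified_snoc[rotated])
    moreover have "insert e D \<subseteq> out_edges es (set (q @ [w]))"
      using eD by (auto simp: out_edges_def)
    moreover have "set (q @ [w]) = {v. v < N \<and> thr v \<le> settled es (insert e D) v}"
      using thr w(2) unfolding set_append sq set_ins by auto
    moreover have "\<forall>v<N. (c(w := 0)) v = thr v - settled es (insert e D) v"
      using thr c w(2) by (simp add: set_ins)
    ultimately show ?thesis
      using dq wq unfolding propagating_def by simp
  qed
qed

definition stores :: "(nat \<Rightarrow> nat) \<Rightarrow> nat list \<Rightarrow> bool" where
  "stores a xs \<longleftrightarrow> (\<forall>i<length xs. a i = xs ! i)"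

lemma stores_Nil [simp]: "stores a []"
  by (simp add: stores_def)

lemma stores_snoc: "stores a xs \<Longrightarrow> stores (a(length xs := x)) (xs @ [x])"
  by (simp add: stores_def nth_append less_Suc_eq)


section \<open>The propagation graph of an instance\<close>

text \<open>Serves the or-nodes: a finite set of edges has positive cardinality iff it is
  inhabited.\<close>

lemma settled_out_edges_ge_1:
  "1 \<le> settled es (out_edges es P) v \<longleftrightarrow> (\<exists>a\<in>P. (a, v) \<in> set es)"
proof -
  have "1 \<le> settled es (out_edges es P) v \<longleftrightarrow> {e \<in> out_edges es P. dst es e = v} \<noteq> {}"
    unfolding settled_def by (simp add: Suc_le_eq card_gt_0_iff)
  also have "\<dots> \<longleftrightarrow> (\<exists>a\<in>P. (a, v) \<in> set es)"
  proof
    assume "{e \<in> out_edges es P. dst es e = v} \<noteq> {}"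
    then obtain e where "e \<in> {1..length es}" "src es e \<in> P" "dst es e = v"
      by (auto simp: out_edges_def)
    moreover from this have "es ! (e - 1) \<in> set es" by auto
    ultimately show "\<exists>a\<in>P. (a, v) \<in> set es"
      by (metis dst_def src_def prod.collapse)
  next
    assume "\<exists>a\<in>P. (a, v) \<in> set es"
    then obtain a i where "a \<in> P" "i < length es" "es ! i = (a, v)"
      by (metis in_set_conv_nth)
    then have "Suc i \<in> {e \<in> out_edges es P. dst es e = v}"
      by (simp add: out_edges_def src_def dst_def)
    then show "{e \<in> out_edges es P. dst es e = v} \<noteq> {}" by blast
  qed
  finally show ?thesis .
qed

definition indegree :: "(nat \<times> nat) list \<Rightarrow> nat \<Rightarrow> nat" where
  "indegree es = settled es {1..length es}"

text \<open>Serves the and-nodes: the incoming edges from \<open>P\<close> form a subset of the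
  finite set of all incoming edges, so reaching its cardinality means equality.\<close>

lemma indegree_le_settled_out_edges:
  "indegree es v \<le> settled es (out_edges es P) v \<longleftrightarrow> (\<forall>a. (a, v) \<in> set es \<longrightarrow> a \<in> P)"
proof -
  let ?A = "{e \<in> out_edges es P. dst es e = v}" and ?B = "{e \<in> {1..length es}. dst es e = v}"
  have sub: "?A \<subseteq> ?B" by (auto simp: out_edges_def)
  have "indegree es v \<le> settled es (out_edges es P) v \<longleftrightarrow> ?A = ?B"
    unfolding indegree_def settled_def using card_seteq[OF _ sub] by auto
  also have "\<dots> \<longleftrightarrow> (\<forall>a. (a, v) \<in> set es \<longrightarrow> a \<in> P)"
  proof
    assume eq: "?A = ?B"
    show "\<forall>a. (a, v) \<in> set es \<longrightarrow> a \<in> P"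
    proof (intro allI impI)
      fix a assume "(a, v) \<in> set es"
      then obtain i where "i < length es" "es ! i = (a, v)"
        by (metis in_set_conv_nth)
      then have "Suc i \<in> ?B" "src es (Suc i) = a" by (simp_all add: src_def dst_def)
      then show "a \<in> P" using eq by (auto simp: out_edges_def)
    qed
  next
    assume *: "\<forall>a. (a, v) \<in> set es \<longrightarrow> a \<in> P"
    have "e \<in> ?A" if "e \<in> ?B" for e
    proof -
      from that have "es ! (e - 1) \<in> set es" by auto
      then have "src es e \<in> P"
        using * that by (metis (mono_tags, lifting) dst_def mem_Collect_eq src_def prod.collapse)
      then show ?thesis using that by (auto simp: out_edges_def)
    qed
    then show "?A = ?B" using sub by blast
  qed
  finally show ?thesis .
qed

lemma indegree_snoc:
  "indegree (es @ [(a, b)]) v = (if v = b then Suc (indegree es v) else indegree es v)"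
proof -
  have "dst (es @ [(a, b)]) e = dst es e" if "e \<in> {1..length es}" for e
    using that by (auto simp: dst_def nth_append)
  then have "settled (es @ [(a, b)]) {1..length es} v = indegree es v"
    unfolding indegree_def settled_def by (intro arg_cong[of _ _ card]) auto
  moreover have "{1..length (es @ [(a, b)])} = insert (Suc (length es)) {1..length es}"
    by auto
  moreover have "dst (es @ [(a, b)]) (Suc (length es)) = b"
    by (simp add: dst_def)
  ultimately show ?thesis
    by (auto simp: indegree_def settled_insert)
qed

text \<open>The nodes are the elements \<open>x < n\<close>, and for the \<open>i\<close>-th set the node \<open>n + 2 * i\<close>, which
  fires with the first element of the set, and the node \<open>n + 2 * i + 1\<close>, which fires
  once all sets that have to come before the \<open>i\<close>-th one have been started.\<close>

locale oba_instance =
  fixes n :: nat and qs :: "nat list list" and rs :: "(nat \<times> nat) list"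
  assumes members: "q \<in> set qs \<Longrightarrow> set q \<subseteq> {..<n}"
    and pairs: "set rs \<subseteq> {..<length qs} \<times> {..<length qs}"
begin

text \<open>The edge \<open>(x, n + 2 * i)\<close> lets a member start its set, and
  \<open>(n + 2 * i + 1, x)\<close> makes it wait until the set is open. Their order is the one in
  which the program adds them, which fixes the edge numbers.\<close>

definition member_edges :: "nat \<Rightarrow> nat list \<Rightarrow> (nat \<times> nat) list" where
  "member_edges i xs = concat (map (\<lambda>x. [(x, n + 2 * i), (n + 2 * i + 1, x)]) xs)"

definition set_edges :: "nat \<Rightarrow> (nat \<times> nat) list" where
  "set_edges k = concat (map (\<lambda>i. member_edges i (qs ! i)) [0..<k])"

definition pair_edges :: "(nat \<times> nat) list \<Rightarrow> (nat \<times> nat) list" where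
  "pair_edges = map (\<lambda>(i, j). (n + 2 * i, n + 2 * j + 1))"

definition edges :: "(nat \<times> nat) list" where
  "edges = set_edges (length qs) @ pair_edges rs"

definition start_nodes :: "nat \<Rightarrow> nat set" where
  "start_nodes k = (\<lambda>i. n + 2 * i) ` {..<k}"

text \<open>Start nodes are or-nodes. All others are and-nodes, including elements of no set, whose
  threshold is 0.\<close>

definition threshold :: "nat \<Rightarrow> nat" where
  "threshold v = (if v \<in> start_nodes (length qs) then 1 else indegree edges v)"

lemma set_edges_iff:
  "(a, b) \<in> set edges \<longleftrightarrow>
     (\<exists>i<length qs. a \<in> set (qs ! i) \<and> b = n + 2 * i) \<or>
     (\<exists>i<length qs. b \<in> set (qs ! i) \<and> a = n + 2 * i + 1) \<or>
     (\<exists>i j. (i, j) \<in> set rs \<and> a = n + 2 * i \<and> b = n + 2 * j + 1)"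
  by (auto simp: edges_def set_edges_def member_edges_def pair_edges_def)

lemma length_member_edges: "length (member_edges i xs) = 2 * length xs"
  by (induction xs) (simp_all add: member_edges_def)

lemma length_set_edges:
  "k \<le> length qs \<Longrightarrow> length (set_edges k) = 2 * length (concat (take k qs))"
  by (induction k)
    (simp_all add: set_edges_def length_member_edges take_Suc_conv_app_nth)

lemma length_edges: "length edges = 2 * length (concat qs) + length rs"
  by (simp add: edges_def length_set_edges pair_edges_def)

lemma member_less: "i < length qs \<Longrightarrow> x \<in> set (qs ! i) \<Longrightarrow> x < n"
  using members nth_mem by blast

text \<open>Elements lie below \<open>n\<close>, and the two nodes of a set are told apart by the
  parity of their offset from \<open>n\<close>; hence only one kind of edge can enter each kind of
  node. The same holds for the next two lemmas.\<close>

lemma in_edges_element: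
  "x < n \<Longrightarrow> (a, x) \<in> set edges \<longleftrightarrow> (\<exists>i<length qs. x \<in> set (qs ! i) \<and> a = n + 2 * i + 1)"
  by (auto simp: set_edges_iff)

lemma in_edges_start:
  "i < length qs \<Longrightarrow> (a, n + 2 * i) \<in> set edges \<longleftrightarrow> a \<in> set (qs ! i)"
  by (auto simp: set_edges_iff dest: member_less) presburger+

lemma in_edges_open:
  "(a, n + 2 * j + 1) \<in> set edges \<longleftrightarrow> (\<exists>i. (i, j) \<in> set rs \<and> a = n + 2 * i)"
  by (auto simp: set_edges_iff dest: member_less) presburger+

text \<open>Here and in the two lemmas below, the firing condition is translated back into
  membership and pairs.\<close>

lemma threshold_element:
  "x < n \<Longrightarrow> threshold x \<le> settled edges (out_edges edges P) x \<longleftrightarrow>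
     (\<forall>i<length qs. x \<in> set (qs ! i) \<longrightarrow> n + 2 * i + 1 \<in> P)"
  using in_edges_element[of x]
  by (auto simp: threshold_def start_nodes_def indegree_le_settled_out_edges)

lemma threshold_start:
  "i < length qs \<Longrightarrow> threshold (n + 2 * i) \<le> settled edges (out_edges edges P) (n + 2 * i) \<longleftrightarrow>
     (\<exists>x\<in>set (qs ! i). x \<in> P)"
proof -
  assume i: "i < length qs"
  then have "threshold (n + 2 * i) = 1"
    by (auto simp: threshold_def start_nodes_def)
  then show ?thesis
    using settled_out_edges_ge_1[of edges P "n + 2 * i"] in_edges_start[OF i] by auto
qed

lemma threshold_open:
  "threshold (n + 2 * j + 1) \<le> settled edges (out_edges edges P) (n + 2 * j + 1) \<longleftrightarrow>
     (\<forall>i. (i, j) \<in> set rs \<longrightarrow> n + 2 * i \<in> P)"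
proof -
  have "n + 2 * j + 1 \<notin> start_nodes (length qs)"
    by (auto simp: start_nodes_def) presburger
  then have "threshold (n + 2 * j + 1) = indegree edges (n + 2 * j + 1)"
    by (simp add: threshold_def)
  then show ?thesis
    using indegree_le_settled_out_edges[of edges "n + 2 * j + 1" P] in_edges_open[of _ j] by auto
qed

text \<open>Justifications are traced backwards: before \<open>y\<close> stands
  \<open>n + 2 * j + 1\<close>, before that \<open>n + 2 * i\<close>, and before that a member of
  the \<open>i\<close>-th set.\<close>

lemma justified_sound:
  assumes q: "justified edges threshold q" "q = a @ y # b"
    and y: "y \<in> set (qs ! j)" and ij: "(i, j) \<in> set rs"
  shows "\<exists>x\<in>set (qs ! i). x \<in> set a"
proof -
  have i: "i < length qs" and j: "j < length qs"
    using pairs ij by auto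
  have just: "threshold v \<le> settled edges (out_edges edges (set a')) v"
    if "q = a' @ v # b'" for a' v b'
    using q(1) that unfolding justified_def by blast
  have "n + 2 * j + 1 \<in> set a"
    using just[OF q(2)] threshold_element[OF member_less[OF j y]] j y by blast
  then obtain a1 b1 where a: "a = a1 @ (n + 2 * j + 1) # b1"
    by (auto dest: split_list)
  have "n + 2 * i \<in> set a1"
    using just[of a1 "n + 2 * j + 1" "b1 @ y # b"] threshold_open[of j] ij q(2) a by simp
  then obtain a2 b2 where a1: "a1 = a2 @ (n + 2 * i) # b2"
    by (auto dest: split_list)
  show ?thesis
    using just[of a2 "n + 2 * i" "b2 @ (n + 2 * j + 1) # b1 @ y # b"] threshold_start[OF i]
      q(2) a a1 by auto
qed

text \<open>A stuck propagation excludes every suitable \<open>prec\<close>. A minimal element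
  \<open>u\<close> outside \<open>q\<close> is blocked, so some set \<open>j\<close> containing it
  is not open, so some set \<open>i\<close> required by \<open>j\<close> has no member in
  \<open>q\<close>. But \<open>before\<close> puts a member of set \<open>i\<close> before
  \<open>u\<close>, against minimality.\<close>

lemma closed_complete:
  assumes closed: "\<And>v. v < n + 2 * length qs \<Longrightarrow>
      threshold v \<le> settled edges (out_edges edges (set q)) v \<Longrightarrow> v \<in> set q"
    and minimal: "\<And>U. U \<subseteq> {..<n} \<Longrightarrow> U \<noteq> {} \<Longrightarrow> \<exists>u\<in>U. \<forall>x\<in>U. \<not> prec x u"
    and before: "\<And>i j. (i, j) \<in> set rs \<Longrightarrow> qs ! j \<noteq> [] \<Longrightarrow>
      \<exists>x\<in>set (qs ! i). \<forall>y\<in>set (qs ! j). prec x y"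
  shows "{..<n} \<subseteq> set q"
proof (rule ccontr)
  assume "\<not> {..<n} \<subseteq> set q"
  then obtain u where u: "u < n" "u \<notin> set q"
    and min: "\<And>x. x < n \<Longrightarrow> x \<notin> set q \<Longrightarrow> \<not> prec x u"
    using minimal[of "{..<n} - set q"] by auto
  from u closed[of u] threshold_element[of u "set q"]
  obtain j where j: "j < length qs" "u \<in> set (qs ! j)" "n + 2 * j + 1 \<notin> set q"
    by auto
  from closed[of "n + 2 * j + 1"] threshold_open[of j "set q"] j
  obtain i where i: "(i, j) \<in> set rs" "n + 2 * i \<notin> set q"
    by auto
  then have "i < length qs" using pairs by auto
  with closed[of "n + 2 * i"] threshold_start[of i "set q"] i
  have out: "x \<notin> set q" if "x \<in> set (qs ! i)" for x
    using that by auto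
  obtain x where x: "x \<in> set (qs ! i)" "prec x u"
    using before[OF i(1)] j(2) by fastforce
  show False
    using min[OF member_less[OF \<open>i < length qs\<close> x(1)] out[OF x(1)]] x(2) by simp
qed

end


section \<open>Building the graph\<close>

abbreviation sequence :: "com \<Rightarrow> com \<Rightarrow> com" (infixr ";;" 60) where
  "c\<^sub>1 ;; c\<^sub>2 \<equiv> Seq c\<^sub>1 c\<^sub>2"

text \<open>Registers 0 to 3 and arrays 0 to 4 are prescribed by the input and output conventions.
  \<open>rZero\<close> is never assigned, so it keeps its initial 0.\<close>

abbreviation (input) rN :: nat where "rN \<equiv> 0"
abbreviation (input) rSets :: nat where "rSets \<equiv> 1"
abbreviation (input) rPairs :: nat where "rPairs \<equiv> 2"
abbreviation (input) rVerdict :: nat where "rVerdict \<equiv> 3"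
abbreviation (input) rZero :: nat where "rZero \<equiv> 4"
abbreviation (input) rOne :: nat where "rOne \<equiv> 5"
abbreviation (input) rI :: nat where "rI \<equiv> 6"
abbreviation (input) rNodes :: nat where "rNodes \<equiv> 7"
abbreviation (input) rStart :: nat where "rStart \<equiv> 8"
abbreviation (input) rOpen :: nat where "rOpen \<equiv> 9"
abbreviation (input) rPos :: nat where "rPos \<equiv> 10"
abbreviation (input) rEnd :: nat where "rEnd \<equiv> 11"
abbreviation (input) rX :: nat where "rX \<equiv> 12"
abbreviation (input) rC :: nat where "rC \<equiv> 13"
abbreviation (input) rEdges :: nat where "rEdges \<equiv> 14"
abbreviation (input) rTmp :: nat where "rTmp \<equiv> 15"
abbreviation (input) rOut :: nat where "rOut \<equiv> 16"
abbreviation (input) rPopped :: nat where "rPopped \<equiv> 17"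
abbreviation (input) rPushed :: nat where "rPushed \<equiv> 18"

abbreviation (input) aMembers :: nat where "aMembers \<equiv> 0"
abbreviation (input) aOffsets :: nat where "aOffsets \<equiv> 1"
abbreviation (input) aFst :: nat where "aFst \<equiv> 2"
abbreviation (input) aSnd :: nat where "aSnd \<equiv> 3"
abbreviation (input) aOut :: nat where "aOut \<equiv> 4"
abbreviation (input) aStart :: nat where "aStart \<equiv> 5"
abbreviation (input) aOpen :: nat where "aOpen \<equiv> 6"
abbreviation (input) aCount :: nat where "aCount \<equiv> 7"
abbreviation (input) aHead :: nat where "aHead \<equiv> 8"
abbreviation (input) aNext :: nat where "aNext \<equiv> 9"
abbreviation (input) aDst :: nat where "aDst \<equiv> 10"
abbreviation (input) aQueue :: nat where "aQueue \<equiv> 11"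

text \<open>Incrementing first reserves 0 as the null pointer.\<close>

definition add_edge :: "nat \<Rightarrow> nat \<Rightarrow> com" where
  "add_edge x y =
     Inc rEdges ;;
     Store aDst rEdges y ;;
     Load rTmp aHead x ;;
     Store aNext rEdges rTmp ;;
     Store aHead x rEdges"

definition count_up :: "nat \<Rightarrow> com" where
  "count_up x = Load rC aCount x ;; Inc rC ;; Store aCount x rC"

text \<open>Only the counter of the element is raised: the demand of a start node is 1 whatever its
  indegree. \<open>rPos\<close> runs on from set to set, since the members are stored
  consecutively.\<close>

definition build_members :: com where
  "build_members = WhileLess rPos rEnd
    (Load rX aMembers rPos ;;
     add_edge rX rStart ;;
     add_edge rOpen rX ;;
     count_up rX ;;
     Inc rPos)"

text \<open>\<open>rEnd\<close> is loaded after \<open>rI\<close> has been incremented, as set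
  \<open>i\<close> ends at entry \<open>i + 1\<close> of the offsets. The counter of the second node
  stays 0 until pairs are added.\<close>

definition new_set :: com where
  "new_set =
    Store aStart rI rNodes ;;
    Store aCount rNodes rOne ;;
    Copy rStart rNodes ;;
    Inc rNodes ;;
    Store aOpen rI rNodes ;;
    Copy rOpen rNodes ;;
    Inc rNodes ;;
    Inc rI ;;
    Load rEnd aOffsets rI"

definition build_sets :: com where
  "build_sets =
    Const rI 0 ;;
    Const rPos 0 ;;
    Const rOne 1 ;;
    Copy rNodes rN ;;
    WhileLess rI rSets (new_set ;; build_members)"

definition build_pairs :: com where
  "build_pairs =
    Const rI 0 ;;
    WhileLess rI rPairs
     (Load rStart aFst rI ;;
      Load rStart aStart rStart ;;
      Load rOpen aSnd rI ;;
      Load rOpen aOpen rOpen ;;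
      add_edge rStart rOpen ;;
      count_up rOpen ;;
      Inc rI)"

lemma stores_upt_snoc:
  "stores a (map f [0..<k]) \<Longrightarrow> stores (a(k := f k)) (map f [0..<Suc k])"
  using stores_snoc[of a "map f [0..<k]" "f k"] by simp

section \<open>Invariants and running time of the graph construction\<close>

context oba_instance
begin

definition offset :: "nat \<Rightarrow> nat" where
  "offset i = length (concat (take i qs))"

lemma offset_0 [simp]: "offset 0 = 0"
  by (simp add: offset_def)

lemma offset_Suc: "i < length qs \<Longrightarrow> offset (Suc i) = offset i + length (qs ! i)"
  by (simp add: offset_def take_Suc_conv_app_nth)

lemma offset_mono: "offset i \<le> offset (length qs)"
proof -
  have "concat qs = concat (take i qs) @ concat (drop i qs)"
    by (metis append_take_drop_id concat_append)
  then show ?thesis by (simp add: offset_def)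
qed

lemma nth_offset:
  assumes "i < length qs" "j < length (qs ! i)"
  shows "concat qs ! (offset i + j) = qs ! i ! j" "offset i + j < length (concat qs)"
proof -
  have "concat qs = concat (take i qs) @ qs ! i @ concat (drop (Suc i) qs)"
    by (metis append_take_drop_id concat.simps(2) concat_append id_take_nth_drop assms(1))
  then show "concat qs ! (offset i + j) = qs ! i ! j" "offset i + j < length (concat qs)"
    using assms(2) by (simp_all add: offset_def nth_append)
qed

definition input :: "state \<Rightarrow> bool" where
  "input s \<longleftrightarrow> reg s rN = n \<and> reg s rSets = length qs \<and> reg s rPairs = length rs \<and>
     reg s rZero = 0 \<and>
     (\<forall>k<length (concat qs). arr s aMembers k = concat qs ! k) \<and>
     (\<forall>i\<le>length qs. arr s aOffsets i = offset i) \<and>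
     (\<forall>k<length rs. arr s aFst k = fst (rs ! k)) \<and>
     (\<forall>k<length rs. arr s aSnd k = snd (rs ! k))"

text \<open>\<open>k\<close> counts the sets whose nodes exist and \<open>es\<close> lists the edges
  added so far; with all sets and \<open>edges\<close> the counters become
  \<open>threshold\<close>.\<close>

definition graph :: "nat \<Rightarrow> (nat \<times> nat) list \<Rightarrow> nat \<Rightarrow> (nat \<Rightarrow> nat) \<Rightarrow> (nat \<Rightarrow> nat) \<Rightarrow>
    (nat \<Rightarrow> nat) \<Rightarrow> (nat \<Rightarrow> nat) \<Rightarrow> bool" where
  "graph k es e d hds nx c \<longleftrightarrow> adjacency es e d hds nx \<and>
     (\<forall>v. c v = (if v \<in> start_nodes k then 1 else indegree es v))"

abbreviation graph_in :: "nat \<Rightarrow> (nat \<times> nat) list \<Rightarrow> state \<Rightarrow> bool" where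
  "graph_in k es s \<equiv>
     graph k es (reg s rEdges) (arr s aDst) (arr s aHead) (arr s aNext) (arr s aCount)"

lemma graph_start_node:
  "graph k es e d hds nx c \<Longrightarrow> graph (Suc k) es e d hds nx (c(n + 2 * k := 1))"
  by (auto simp: graph_def start_nodes_def lessThan_Suc)

lemma graph_snoc_start:
  "graph k es e d hds nx c \<Longrightarrow> b \<in> start_nodes k \<Longrightarrow>
     graph k (es @ [(a, b)]) (Suc e) (d(Suc e := b)) (hds(a := Suc e)) (nx(Suc e := hds a)) c"
  by (auto simp: graph_def adjacency_snoc indegree_snoc)

lemma graph_snoc:
  "graph k es e d hds nx c \<Longrightarrow> b \<notin> start_nodes k \<Longrightarrow>
     graph k (es @ [(a, b)]) (Suc e) (d(Suc e := b)) (hds(a := Suc e)) (nx(Suc e := hds a))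
       (c(b := Suc (c b)))"
  by (auto simp: graph_def adjacency_snoc indegree_snoc)

lemma graph_member:
  assumes "graph k es e d hds nx c" "i < k" "x < n"
  shows "graph k (es @ member_edges i [x]) (Suc (Suc e))
     (d(Suc e := n + 2 * i, Suc (Suc e) := x))
     (hds(x := Suc e, n + 2 * i + 1 := Suc (Suc e)))
     (nx(Suc e := hds x, Suc (Suc e) := hds (n + 2 * i + 1)))
     (c(x := Suc (c x)))"
proof -
  have "n + 2 * i \<in> start_nodes k" "x \<notin> start_nodes k"
    using assms(2,3) by (auto simp: start_nodes_def)
  from graph_snoc[OF graph_snoc_start[OF assms(1) this(1), of x] this(2), of "n + 2 * i + 1"] assms(3)
  show ?thesis by (simp add: member_edges_def)
qed

text \<open>The machine only adds and subtracts one, so the node numbers of a set are looked up;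
  recomputing \<open>n + 2 * i\<close> for every pair would not take constant time.\<close>

definition tables :: "nat \<Rightarrow> state \<Rightarrow> bool" where
  "tables k s \<longleftrightarrow> stores (arr s aStart) (map (\<lambda>i. n + 2 * i) [0..<k]) \<and>
     stores (arr s aOpen) (map (\<lambda>i. n + 2 * i + 1) [0..<k])"

definition sets_built :: "nat \<Rightarrow> nat \<Rightarrow> (nat \<times> nat) list \<Rightarrow> state \<Rightarrow> bool" where
  "sets_built i p es s \<longleftrightarrow> input s \<and> reg s rOne = 1 \<and> reg s rI = i \<and>
     reg s rNodes = n + 2 * i \<and> reg s rPos = p \<and> graph_in i es s \<and> tables i s"

lemma member_edges_snoc:
  "j < length xs \<Longrightarrow>
    member_edges i (take (Suc j) xs) = member_edges i (take j xs) @ member_edges i [xs ! j]"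
  by (simp add: member_edges_def take_Suc_conv_app_nth)

text \<open>Each member costs 15 commands and one test; the failing last test is the additional
  1.\<close>

lemma wp_build_members:
  assumes i: "i < length qs"
    and s: "sets_built (Suc i) (offset i) es s"
      "reg s rStart = n + 2 * i" "reg s rOpen = n + 2 * i + 1" "reg s rEnd = offset (Suc i)"
  shows "wp build_members (\<lambda>t s'.
    sets_built (Suc i) (offset (Suc i)) (es @ member_edges i (qs ! i)) s' \<and>
    t \<le> 16 * length (qs ! i) + 1) s"
proof -
  let ?I = "\<lambda>t s. \<exists>j\<le>length (qs ! i).
    sets_built (Suc i) (offset i + j) (es @ member_edges i (take j (qs ! i))) s \<and>
    reg s rStart = n + 2 * i \<and> reg s rOpen = n + 2 * i + 1 \<and> reg s rEnd = offset (Suc i) \<and>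
    t \<le> 16 * j"
  show ?thesis
    unfolding build_members_def
  proof (rule wp_WhileLess[where I = ?I and b = "16 * length (qs ! i)"], goal_cases)
    case 1
    show ?case using s by (intro exI[of _ 0]) (simp add: member_edges_def)
  next
    case (2 t s)
    then show ?case by force
  next
    case (3 t s)
    then obtain j where j: "j \<le> length (qs ! i)"
      and b: "sets_built (Suc i) (offset i + j) (es @ member_edges i (take j (qs ! i))) s"
      and r: "reg s rStart = n + 2 * i" "reg s rOpen = n + 2 * i + 1"
        "reg s rEnd = offset (Suc i)"
      and t: "t \<le> 16 * j"
      by blast
    have less: "j < length (qs ! i)"
      using 3(2) b r i by (simp add: sets_built_def offset_Suc)
    define x where "x = qs ! i ! j"
    have x: "x < n" using less member_less[OF i] by (simp add: x_def)
    \<comment> \<open>The second edge reads the list head of node \<open>n + 2 * i + 1\<close> after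
      that of \<open>x\<close> has been overwritten, so the two cells must differ.\<close>
    then have neq: "Suc (n + 2 * i) \<noteq> x" by simp
    have ld: "arr s aMembers (offset i + j) = x"
      using b nth_offset[OF i less] by (simp add: sets_built_def input_def x_def)
    have g: "graph_in (Suc i) (es @ member_edges i (take j (qs ! i))) s"
      using b by (simp add: sets_built_def)
    note g' = graph_member[OF g lessI x]
    have "wp (Load rX aMembers rPos ;; add_edge rX rStart ;; add_edge rOpen rX ;;
        count_up rX ;; Inc rPos)
      (\<lambda>t' s'. t' = 15 \<and>
        sets_built (Suc i) (offset i + Suc j) (es @ member_edges i (take (Suc j) (qs ! i))) s' \<and>
        reg s' rStart = n + 2 * i \<and> reg s' rOpen = n + 2 * i + 1 \<and> reg s' rEnd = offset (Suc i)) s"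
      using b r ld g' neq
      by (simp add: add_edge_def count_up_def sets_built_def input_def tables_def
          member_edges_snoc[OF less] x_def[symmetric])
    then show ?case
    proof (rule wp_mono)
      fix t' :: nat and s' :: state
      assume "t' = 15 \<and>
        sets_built (Suc i) (offset i + Suc j) (es @ member_edges i (take (Suc j) (qs ! i))) s' \<and>
        reg s' rStart = n + 2 * i \<and> reg s' rOpen = n + 2 * i + 1 \<and> reg s' rEnd = offset (Suc i)"
      with t less show "?I (t + t' + 1) s'"
        by (intro exI[of _ "Suc j"]) simp
    qed
  next
    case (4 t s)
    then obtain j where j: "j \<le> length (qs ! i)"
      and b: "sets_built (Suc i) (offset i + j) (es @ member_edges i (take j (qs ! i))) s"
      and r: "reg s rEnd = offset (Suc i)"
      and t: "t \<le> 16 * j"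
      by blast
    have "j = length (qs ! i)"
      using 4(2) b r i j by (simp add: sets_built_def offset_Suc)
    then show ?case using b t i by (simp add: offset_Suc)
  qed
qed

text \<open>The 11 steps per set are nine in \<open>new_set\<close>, the outer test and the failing
  inner test. Members are charged separately, at 16 each, so the nested loops stay linear.\<close>

lemma wp_build_sets:
  assumes s: "input s" "graph_in 0 [] s"
  shows "wp build_sets (\<lambda>t s'. input s' \<and> reg s' rNodes = n + 2 * length qs \<and>
    graph_in (length qs) (set_edges (length qs)) s' \<and> tables (length qs) s' \<and>
    t \<le> 11 * length qs + 16 * length (concat qs) + 5) s"
proof -
  let ?I = "\<lambda>t s. \<exists>i\<le>length qs. sets_built i (offset i) (set_edges i) s \<and>
    t \<le> 11 * i + 16 * offset i"
  have off: "offset i \<le> length (concat qs)" for i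
    using offset_mono[of i] by (simp add: offset_def)
  have loop: "wp (WhileLess rI rSets (new_set ;; build_members))
     (\<lambda>t s'. input s' \<and> reg s' rNodes = n + 2 * length qs \<and>
    graph_in (length qs) (set_edges (length qs)) s' \<and> tables (length qs) s' \<and>
    t \<le> 11 * length qs + 16 * length (concat qs) + 1) s"
    if "sets_built 0 0 [] s" for s
  proof (rule wp_WhileLess[where I = ?I and b = "11 * length qs + 16 * length (concat qs)"],
      goal_cases)
    case 1
    show ?case using that by (intro exI[of _ 0]) (simp add: set_edges_def)
  next
    case (2 t s)
    then obtain i where "i \<le> length qs" "t \<le> 11 * i + 16 * offset i" by blast
    then show ?case using off[of i] by linarith
  next
    case (3 t s)
    then obtain i where b: "sets_built i (offset i) (set_edges i) s"
      and t: "t \<le> 11 * i + 16 * offset i"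
      by blast
    have i: "i < length qs"
      using 3(2) b by (simp add: sets_built_def input_def)
    have g: "graph_in i (set_edges i) s" and tb: "tables i s"
      using b by (simp_all add: sets_built_def)
    note g' = graph_start_node[OF g]
    have tb': "stores ((arr s aStart)(i := n + 2 * i)) (map (\<lambda>i. n + 2 * i) [0..<Suc i])"
        "stores ((arr s aOpen)(i := n + 2 * i + 1)) (map (\<lambda>i. n + 2 * i + 1) [0..<Suc i])"
      using tb stores_upt_snoc[where f = "\<lambda>i. n + 2 * i"]
        stores_upt_snoc[where f = "\<lambda>i. n + 2 * i + 1"] unfolding tables_def by blast+
    have new: "wp new_set
      (\<lambda>t s'. t = 9 \<and> sets_built (Suc i) (offset i) (set_edges i) s' \<and>
        reg s' rStart = n + 2 * i \<and> reg s' rOpen = n + 2 * i + 1 \<and>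
        reg s' rEnd = offset (Suc i)) s"
      using b g' tb' i
      by (simp add: new_set_def sets_built_def input_def tables_def Suc_le_eq del: upt_Suc)
    show ?case
      unfolding wp_Seq
    proof (rule wp_mono[OF new], elim conjE, rule wp_mono[OF wp_build_members[OF i]], assumption+)
      fix t\<^sub>1 s\<^sub>1 t\<^sub>2 s\<^sub>2
      assume "t\<^sub>1 = (9::nat)"
        "sets_built (Suc i) (offset (Suc i)) (set_edges i @ member_edges i (qs ! i)) s\<^sub>2 \<and>
         t\<^sub>2 \<le> 16 * length (qs ! i) + 1"
      with t i show "?I (t + (t\<^sub>1 + t\<^sub>2) + 1) s\<^sub>2"
        by (intro exI[of _ "Suc i"]) (simp add: offset_Suc set_edges_def)
    qed
  next
    case (4 t s)
    then obtain i where "i \<le> length qs" "sets_built i (offset i) (set_edges i) s"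
      and t: "t \<le> 11 * i + 16 * offset i"
      by blast
    moreover from this 4(2) have "i = length qs"
      by (simp add: sets_built_def input_def)
    ultimately show ?case
      using off[of "length qs"] by (simp add: sets_built_def)
  qed
  show ?thesis
    unfolding build_sets_def
    by (simp del: One_nat_def, rule wp_mono[OF loop])
      (use s in \<open>auto simp: sets_built_def input_def tables_def\<close>)
qed

lemma wp_build_pairs:
  assumes s: "input s" "reg s rNodes = n + 2 * length qs"
    "graph_in (length qs) (set_edges (length qs)) s" "tables (length qs) s"
  shows "wp build_pairs (\<lambda>t s'. input s' \<and> reg s' rNodes = n + 2 * length qs \<and>
    graph_in (length qs) edges s' \<and> t \<le> 15 * length rs + 2) s"
proof -
  let ?I = "\<lambda>t s. input s \<and> reg s rNodes = n + 2 * length qs \<and> tables (length qs) s \<and>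
    reg s rI \<le> length rs \<and>
    graph_in (length qs) (set_edges (length qs) @ pair_edges (take (reg s rI) rs)) s \<and>
    t \<le> 15 * reg s rI"
  have loop: "wp (WhileLess rI rPairs
     (Load rStart aFst rI ;; Load rStart aStart rStart ;; Load rOpen aSnd rI ;;
      Load rOpen aOpen rOpen ;; add_edge rStart rOpen ;; count_up rOpen ;; Inc rI))
     (\<lambda>t s'. input s' \<and> reg s' rNodes = n + 2 * length qs \<and>
       graph_in (length qs) edges s' \<and> t \<le> 15 * length rs + 1) s"
    if "?I 0 s" for s
  proof (rule wp_WhileLess[where I = ?I and b = "15 * length rs"], goal_cases)
    case 1
    show ?case using that .
  next
    case (2 t s)
    then show ?case by linarith
  next
    case (3 t s)
    define k where "k = reg s rI"
    define i where "i = fst (rs ! k)"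
    define j where "j = snd (rs ! k)"
    have k: "k < length rs" using 3 by (simp add: input_def k_def)
    then have "rs ! k \<in> {..<length qs} \<times> {..<length qs}"
      using pairs by (meson nth_mem subsetD)
    then have ij: "i < length qs" "j < length qs" and e: "rs ! k = (i, j)"
      by (auto simp: i_def j_def)
    have ld: "arr s aFst k = i" "arr s aSnd k = j" "arr s aStart i = n + 2 * i"
        "arr s aOpen j = Suc (n + 2 * j)"
      using 3(1) k ij by (auto simp: input_def tables_def stores_def i_def j_def)
    \<comment> \<open>By parity the target is not a start node, so its counter is an indegree and
      has to be raised.\<close>
    have nin: "Suc (n + 2 * j) \<notin> start_nodes (length qs)"
      by (auto simp: start_nodes_def) presburger
    have g: "graph_in (length qs) (set_edges (length qs) @ pair_edges (take k rs)) s"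
      using 3 by (simp add: k_def)
    have pe: "pair_edges (take (Suc k) rs) = pair_edges (take k rs) @ [(n + 2 * i, Suc (n + 2 * j))]"
      using k e by (simp add: pair_edges_def take_Suc_conv_app_nth)
    show ?case
      using 3(1) graph_snoc[OF g nin, of "n + 2 * i"] ld k
      by (simp add: k_def[symmetric] add_edge_def count_up_def input_def tables_def pe)
  next
    case (4 t s)
    then have "reg s rI = length rs" by (simp add: input_def)
    with 4 show ?case by (simp add: edges_def)
  qed
  show ?thesis
    unfolding build_pairs_def
    by (simp, rule wp_mono[OF loop])
      (use s in \<open>auto simp: input_def tables_def pair_edges_def\<close>)
qed

end


section \<open>Propagation\<close>

definition init_queue :: com where
  "init_queue =
    Const rI 0 ;;
    Const rPushed 0 ;;
    WhileLess rI rNodes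
     (Load rC aCount rI ;;
      IfLess rZero rC Skip (Store aQueue rPushed rI ;; Inc rPushed) ;;
      Inc rI)"

text \<open>A zero counter marks a node already queued, which is skipped; a node is queued at the
  moment its counter drops to 0.\<close>

definition follow_edge :: com where
  "follow_edge =
    Load rX aDst rPos ;;
    Load rC aCount rX ;;
    IfLess rZero rC
      (Dec rC ;;
       Store aCount rX rC ;;
       IfLess rZero rC Skip (Store aQueue rPushed rX ;; Inc rPushed))
      Skip ;;
    Load rPos aNext rPos"

text \<open>Nodes of sets are popped as well, but only elements are written out, so the output is
  the queue restricted to elements.\<close>

definition pop_node :: com where
  "pop_node =
    Load rX aQueue rPopped ;;
    Inc rPopped ;;
    IfLess rX rN (Store aOut rOut rX ;; Inc rOut) Skip ;;
    Load rPos aHead rX"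

definition propagate :: com where
  "propagate =
    Const rPopped 0 ;;
    Const rOut 0 ;;
    WhileLess rPopped rPushed (pop_node ;; WhileLess rZero rPos follow_edge)"

definition give_verdict :: com where
  "give_verdict = IfLess rOut rN (Const rVerdict 0) (Const rVerdict 1)"

definition find_order :: com where
  "find_order = build_sets ;; build_pairs ;; init_queue ;; propagate ;; give_verdict"

section \<open>Invariants and running time of the propagation\<close>

context oba_instance
begin

abbreviation nodes :: nat where
  "nodes \<equiv> n + 2 * length qs"

definition propagated :: "nat set \<Rightarrow> nat list \<Rightarrow> state \<Rightarrow> bool" where
  "propagated D q s \<longleftrightarrow> reg s rN = n \<and> reg s rZero = 0 \<and>
     adjacency edges (reg s rEdges) (arr s aDst) (arr s aHead) (arr s aNext) \<and>
     propagating edges threshold nodes D q (arr s aCount) \<and>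
     stores (arr s aQueue) q \<and> reg s rPushed = length q"

lemma graph_edges:
  "graph (length qs) edges e d hds nx c \<longleftrightarrow>
     adjacency edges e d hds nx \<and> (\<forall>v. c v = threshold v)"
  by (simp add: graph_def threshold_def)

lemma wp_init_queue:
  assumes s: "input s" "reg s rNodes = nodes" "graph_in (length qs) edges s"
  shows "wp init_queue (\<lambda>t s'. propagated {} (filter (\<lambda>v. threshold v = 0) [0..<nodes]) s' \<and>
    t \<le> 6 * nodes + 3) s"
proof -
  let ?q = "\<lambda>k. filter (\<lambda>v. threshold v = 0) [0..<k]"
  let ?I = "\<lambda>t s. input s \<and> reg s rNodes = nodes \<and> graph_in (length qs) edges s \<and>
    reg s rI \<le> nodes \<and> stores (arr s aQueue) (?q (reg s rI)) \<and>
    reg s rPushed = length (?q (reg s rI)) \<and> t \<le> 6 * reg s rI"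
  have loop: "wp (WhileLess rI rNodes
     (Load rC aCount rI ;; IfLess rZero rC Skip (Store aQueue rPushed rI ;; Inc rPushed) ;; Inc rI))
     (\<lambda>t s'. propagated {} (?q nodes) s' \<and> t \<le> 6 * nodes + 1) s"
    if "?I 0 s" for s
  proof (rule wp_WhileLess[where I = ?I and b = "6 * nodes"], goal_cases)
    case 1
    show ?case using that .
  next
    case (2 t s)
    then show ?case by auto
  next
    case (3 t s)
    have "stores ((arr s aQueue)(length (?q (reg s rI)) := reg s rI)) (?q (reg s rI) @ [reg s rI])"
      using 3 stores_snoc by blast
    then show ?case
      using 3 by (cases "threshold (reg s rI) = 0") (simp_all add: input_def graph_edges)
  next
    case (4 t s)
    then have "reg s rI = nodes" by simp
    moreover have "propagating edges threshold nodes {} (?q nodes) (arr s aCount)"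
      using 4 by (intro propagating_start) (simp add: graph_edges)
    ultimately show ?case
      using 4(1) by (simp add: propagated_def graph_edges input_def)
  qed
  show ?thesis
    unfolding init_queue_def
    by (simp, rule wp_mono[OF loop]) (use s in \<open>auto simp: input_def\<close>)
qed

lemma dst_less: "e \<in> {1..length edges} \<Longrightarrow> dst edges e < nodes"
proof -
  assume "e \<in> {1..length edges}"
  then have "edges ! (e - 1) \<in> set edges" by auto
  then have "(src edges e, dst edges e) \<in> set edges" by (simp add: src_def dst_def)
  then show ?thesis
    using pairs by (auto simp: set_edges_iff dest: member_less)
qed

text \<open>Program form of \<open>propagating_step\<close>: \<open>ext\<close> is the target if its
  demand is met just now, and empty otherwise. The unchanged pointers and output are what the
  enclosing loops rely on.\<close>

lemma wp_follow_edge: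
  assumes s: "propagated D q s" and e: "e = reg s rPos" "e \<in> out_edges edges (set q)" "e \<notin> D"
  shows "wp follow_edge (\<lambda>t s'. t \<le> 9 \<and> (\<exists>ext. propagated (insert e D) (q @ ext) s') \<and>
    reg s' rPos = arr s aNext e \<and> arr s' aNext = arr s aNext \<and> reg s' rPopped = reg s rPopped \<and>
    reg s' rOut = reg s rOut \<and> arr s' aOut = arr s aOut) s"
proof -
  define w where "w = dst edges e"
  have w: "w < nodes" using dst_less e(2) by (simp add: w_def out_edges_def)
  have adj: "adjacency edges (reg s rEdges) (arr s aDst) (arr s aHead) (arr s aNext)"
    and p: "propagating edges threshold nodes D q (arr s aCount)"
    and q: "stores (arr s aQueue) q" "reg s rPushed = length q"
    and r: "reg s rN = n" "reg s rZero = 0"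
    using s by (simp_all add: propagated_def)
  have ld: "arr s aDst (reg s rPos) = w"
    using adj e(1,2) by (simp add: adjacency_def out_edges_def w_def)
  note step = propagating_step[OF p e(2,3) w_def w]
  consider "arr s aCount w = 0" | "arr s aCount w = 1" | "arr s aCount w > 1" by linarith
  then show ?thesis
  proof cases
    case 1
    then show ?thesis
      using ld r q adj step(1)
      by (auto simp: follow_edge_def propagated_def e(1)[symmetric] intro!: exI[of _ "[]"])
  next
    case 2
    then show ?thesis
      using ld r q adj step(2) stores_snoc[OF q(1)]
      by (auto simp: follow_edge_def propagated_def e(1)[symmetric] intro!: exI[of _ "[w]"])
  next
    case 3
    then show ?thesis
      using ld r q adj step(3)
      by (auto simp: follow_edge_def propagated_def e(1)[symmetric] intro!: exI[of _ "[]"])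
  qed
qed

text \<open>The invariant splits the list into edges done and still to do. By disjointness from
  \<open>D\<close> and distinctness each edge is new when followed; an iteration costs at most 9
  steps plus its test.\<close>

lemma wp_follow_edges:
  assumes s: "propagated D q s" and v: "v \<in> set q" "reg s rPos = arr s aHead v"
    and D: "D \<inter> set (adj edges v) = {}"
  shows "wp (WhileLess rZero rPos follow_edge) (\<lambda>t s'.
    (\<exists>ext. propagated (D \<union> set (adj edges v)) (q @ ext) s') \<and> reg s' rPopped = reg s rPopped \<and>
    reg s' rOut = reg s rOut \<and> arr s' aOut = arr s aOut \<and> t \<le> 10 * length (adj edges v) + 1) s"
proof -
  let ?I = "\<lambda>t s'. \<exists>done todo ext. adj edges v = done @ todo \<and>
    propagated (D \<union> set done) (q @ ext) s' \<and> chain (arr s' aNext) (reg s' rPos) todo \<and>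
    reg s' rPopped = reg s rPopped \<and> reg s' rOut = reg s rOut \<and> arr s' aOut = arr s aOut \<and>
    t \<le> 10 * length done"
  show ?thesis
  proof (rule wp_WhileLess[where I = ?I and b = "10 * length (adj edges v)"], goal_cases)
    case 1
    have "chain (arr s aNext) (arr s aHead v) (adj edges v)"
      using s by (simp add: propagated_def adjacency_def)
    then show ?case
      using s v by (intro exI[of _ "[]"] exI[of _ "adj edges v"]) simp
  next
    case (2 t s')
    then show ?case by force
  next
    case (3 t s')
    then obtain ks todo ext where split: "adj edges v = ks @ todo"
      and p: "propagated (D \<union> set ks) (q @ ext) s'"
      and ch: "chain (arr s' aNext) (reg s' rPos) todo"
      and fr: "reg s' rPopped = reg s rPopped" "reg s' rOut = reg s rOut" "arr s' aOut = arr s aOut"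
      and t: "t \<le> 10 * length ks"
      by blast
    have "0 < reg s' rPos" using 3(2) p by (simp add: propagated_def)
    with ch obtain e todo' where todo: "todo = e # todo'" and e: "e = reg s' rPos"
      and ch': "chain (arr s' aNext) (arr s' aNext e) todo'"
      by (cases todo) auto
    have "e \<in> set (adj edges v)" using split todo by simp
    then have e_out: "e \<in> out_edges edges (set (q @ ext))"
      using v(1) by (auto simp: set_adj out_edges_def)
    have e_new: "e \<notin> D \<union> set ks"
      using D distinct_adj[of edges v] split todo by auto
    show ?case
    proof (rule wp_mono[OF wp_follow_edge[OF p e e_out e_new]], elim conjE exE)
      fix t' :: nat and s'' :: state and ext'
      assume *: "t' \<le> 9" "propagated (insert e (D \<union> set ks)) ((q @ ext) @ ext') s''"
        "reg s'' rPos = arr s' aNext e" "arr s'' aNext = arr s' aNext"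
        "reg s'' rPopped = reg s' rPopped" "reg s'' rOut = reg s' rOut" "arr s'' aOut = arr s' aOut"
      show "?I (t + t' + 1) s''"
        by (intro exI[of _ "ks @ [e]"] exI[of _ todo'] exI[of _ "ext @ ext'"])
          (use * split todo ch' fr t in simp)
    qed
  next
    case (4 t s')
    then obtain ks todo ext where split: "adj edges v = ks @ todo"
      and p: "propagated (D \<union> set ks) (q @ ext) s'"
      and ch: "chain (arr s' aNext) (reg s' rPos) todo"
      and fr: "reg s' rPopped = reg s rPopped" "reg s' rOut = reg s rOut" "arr s' aOut = arr s aOut"
      and t: "t \<le> 10 * length ks"
      by blast
    have "reg s' rPos = 0" using 4(2) p by (simp add: propagated_def)
    with ch have "todo = []" by (cases todo) auto
    with split p fr t show ?case by auto
  qed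
qed

text \<open>All edges leaving \<open>q\<close> have been followed, so \<open>propagating\<close> now
  says that \<open>q\<close> holds exactly the nodes whose threshold is met by \<open>q\<close>
  itself. This is the closedness used in \<open>closed_complete\<close>.\<close>

definition solved :: "nat list \<Rightarrow> state \<Rightarrow> bool" where
  "solved q s \<longleftrightarrow> reg s rN = n \<and> propagating edges threshold nodes (out_edges edges (set q)) q (arr s aCount) \<and>
     stores (arr s aOut) (filter (\<lambda>v. v < n) q) \<and> reg s rOut = length (filter (\<lambda>v. v < n) q)"

lemma length_propagated: "propagated D q s \<Longrightarrow> length q \<le> nodes"
proof -
  assume "propagated D q s"
  then have "distinct q" "set q \<subseteq> {..<nodes}"
    by (auto simp: propagated_def propagating_def)
  then show ?thesis
    by (metis card_lessThan card_mono distinct_card finite_lessThan)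
qed

definition popped :: "nat \<Rightarrow> nat list \<Rightarrow> state \<Rightarrow> bool" where
  "popped k q s \<longleftrightarrow> k \<le> length q \<and> reg s rPopped = k \<and>
     stores (arr s aOut) (filter (\<lambda>v. v < n) (take k q)) \<and>
     reg s rOut = length (filter (\<lambda>v. v < n) (take k q))"

lemma wp_pop_node:
  assumes s: "propagated D q s" "popped k q s" and k: "k < length q"
  shows "wp pop_node (\<lambda>t s'. t \<le> 6 \<and> propagated D q s' \<and> popped (Suc k) q s' \<and>
    reg s' rPos = arr s' aHead (q ! k)) s"
proof -
  have ld: "arr s aQueue k = q ! k"
    using s(1) k by (simp add: propagated_def stores_def)
  have st: "stores (arr s aOut) (filter (\<lambda>v. v < n) (take k q))"
    using s(2) by (simp add: popped_def)
  show ?thesis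
    using s ld k stores_snoc[OF st, of "q ! k"]
    by (cases "q ! k < n")
      (simp_all add: pop_node_def propagated_def popped_def take_Suc_conv_app_nth)
qed

text \<open>The followed edges are exactly those leaving the first \<open>k\<close> nodes of the
  queue. Charging 8 steps to each popped node and 10 to each followed edge yields a linear bound,
  since no edge is followed twice.\<close>

lemma wp_propagate:
  assumes s: "propagated {} q s"
  shows "wp propagate (\<lambda>t s'. (\<exists>q. solved q s') \<and> t \<le> 8 * nodes + 10 * length edges + 3) s"
proof -
  let ?D = "\<lambda>k q. out_edges edges (set (take k q))"
  let ?I = "\<lambda>t s. \<exists>k q. propagated (?D k q) q s \<and> popped k q s \<and>
    t \<le> 8 * k + 10 * card (?D k q)"
  have loop: "wp (WhileLess rPopped rPushed (pop_node ;; WhileLess rZero rPos follow_edge))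
     (\<lambda>t s'. (\<exists>q. solved q s') \<and> t \<le> 8 * nodes + 10 * length edges + 1) s"
    if init: "propagated {} q s" "popped 0 q s" for s
  proof (rule wp_WhileLess[where I = ?I and b = "8 * nodes + 10 * length edges"], goal_cases)
    case 1
    show ?case using init by (intro exI[of _ 0] exI[of _ q]) simp
  next
    case (2 t s)
    then obtain k q where p: "propagated (?D k q) q s" and k: "k \<le> length q"
      and t: "t \<le> 8 * k + 10 * card (?D k q)"
      by (auto simp: popped_def)
    have "k \<le> nodes" using k length_propagated[OF p] by (rule le_trans)
    with card_out_edges show ?case
      using t by (blast intro: le_trans add_mono mult_le_mono2)
  next
    case (3 t s)
    then obtain k q where p: "propagated (?D k q) q s" and k: "popped k q s"
      and t: "t \<le> 8 * k + 10 * card (?D k q)"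
      by blast
    have less: "k < length q" using 3(2) p k by (simp add: propagated_def popped_def)
    have dq: "distinct q" using p by (simp add: propagated_def propagating_def)
    have new: "q ! k \<notin> set (take k q)"
      using dq less by (auto simp: in_set_conv_nth nth_eq_iff_index_eq)
    have Suc: "set (take (Suc k) q) = insert (q ! k) (set (take k q))"
      using less by (simp add: take_Suc_conv_app_nth)
    have disj: "?D k q \<inter> set (adj edges (q ! k)) = {}"
      using new by (auto simp: out_edges_def set_adj)
    have D_Suc: "?D (Suc k) q = ?D k q \<union> set (adj edges (q ! k))"
      unfolding Suc by (rule out_edges_insert)
    have card_Suc: "card (?D (Suc k) q) = card (?D k q) + length (adj edges (q ! k))"
      unfolding D_Suc using disj by (simp add: card_Un_disjoint distinct_card distinct_adj)
    show ?case
      unfolding wp_Seq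
    proof (rule wp_mono[OF wp_pop_node[OF p k less]], elim conjE)
      fix t\<^sub>1 :: nat and s\<^sub>1 :: state
      assume t1: "t\<^sub>1 \<le> 6" and p1: "propagated (?D k q) q s\<^sub>1" and k1: "popped (Suc k) q s\<^sub>1"
        and pos: "reg s\<^sub>1 rPos = arr s\<^sub>1 aHead (q ! k)"
      show "wp (WhileLess rZero rPos follow_edge) (\<lambda>t'. ?I (t + (t\<^sub>1 + t') + 1)) s\<^sub>1"
      proof (rule wp_mono[OF wp_follow_edges[OF p1 nth_mem[OF less] pos disj]], elim conjE exE)
        fix t\<^sub>2 :: nat and s\<^sub>2 :: state and ext
        assume *: "propagated (?D k q \<union> set (adj edges (q ! k))) (q @ ext) s\<^sub>2"
          "reg s\<^sub>2 rPopped = reg s\<^sub>1 rPopped" "reg s\<^sub>2 rOut = reg s\<^sub>1 rOut" "arr s\<^sub>2 aOut = arr s\<^sub>1 aOut"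
          "t\<^sub>2 \<le> 10 * length (adj edges (q ! k)) + 1"
        \<comment> \<open>Appending to the queue leaves the popped prefix alone.\<close>
        have tk: "take (Suc k) (q @ ext) = take (Suc k) q" using less by simp
        show "?I (t + (t\<^sub>1 + t\<^sub>2) + 1) s\<^sub>2"
        proof (intro exI conjI)
          show "propagated (?D (Suc k) (q @ ext)) (q @ ext) s\<^sub>2"
            unfolding tk D_Suc by (rule *(1))
          show "popped (Suc k) (q @ ext) s\<^sub>2"
            using k1 *(2-4) unfolding popped_def tk by simp
          show "t + (t\<^sub>1 + t\<^sub>2) + 1 \<le> 8 * Suc k + 10 * card (?D (Suc k) (q @ ext))"
            unfolding tk card_Suc using t t1 *(5) by simp
        qed
      qed
    qed
  next
    case (4 t s)
    then obtain k q where p: "propagated (?D k q) q s" and k: "popped k q s"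
      and t: "t \<le> 8 * k + 10 * card (?D k q)"
      by blast
    have k_eq: "k = length q" using 4(2) p k by (simp add: propagated_def popped_def)
    have "solved q s" using p k unfolding k_eq by (simp add: solved_def propagated_def popped_def)
    moreover have "t \<le> 8 * nodes + 10 * length edges"
      using t length_propagated[OF p] card_out_edges unfolding k_eq
      by (blast intro: le_trans add_mono mult_le_mono2)
    ultimately show ?case by auto
  qed
  show ?thesis
    unfolding propagate_def
    by (simp, rule wp_mono[OF loop]) (use s in \<open>auto simp: propagated_def popped_def\<close>)
qed

text \<open>The five bounds are added up, with \<open>nodes\<close> and \<open>length edges\<close>
  expressed by the input sizes. Fewer than \<open>n\<close> elements in the output mean that the
  propagation got stuck.\<close>

lemma wp_find_order:
  assumes s: "input s" "graph_in 0 [] s"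
  shows "wp find_order (\<lambda>t s'.
    (\<exists>q. solved q s' \<and> reg s' rVerdict = (if length (filter (\<lambda>v. v < n) q) < n then 0 else 1)) \<and>
    t \<le> 14 * n + 39 * length qs + 36 * length (concat qs) + 25 * length rs + 15) s"
proof -
  have verdict: "wp give_verdict (\<lambda>t s'.
      (\<exists>q. solved q s' \<and> reg s' rVerdict = (if length (filter (\<lambda>v. v < n) q) < n then 0 else 1)) \<and>
      t = 2) s"
    if "solved q s" for q s
    using that by (auto simp: give_verdict_def solved_def)
  show ?thesis
    unfolding find_order_def wp_Seq
    apply (rule wp_mono[OF wp_build_sets[OF s]], elim conjE)
    apply (rule wp_mono[OF wp_build_pairs], assumption+, elim conjE)
    apply (rule wp_mono[OF wp_init_queue], assumption+, elim conjE)
    apply (rule wp_mono[OF wp_propagate], assumption, elim conjE exE)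
    apply (rule wp_mono[OF verdict], assumption)
    apply (simp add: length_edges)
    done
qed

end


section \<open>From the queue to a linear ordering\<close>

definition list_order :: "'a list \<Rightarrow> 'a rel" where
  "list_order xs = {(xs ! i, xs ! j) | i j. i \<le> j \<and> j < length xs}"

text \<open>Distinctness identifies elements with their indices, which carries over the order of the
  natural numbers.\<close>

lemma linear_order_on_list_order:
  assumes "distinct xs"
  shows "linear_order_on (set xs) (list_order xs)"
proof -
  have iff: "(x, y) \<in> list_order xs \<longleftrightarrow>
      (\<exists>i j. i \<le> j \<and> j < length xs \<and> x = xs ! i \<and> y = xs ! j)" for x y
    by (auto simp: list_order_def)
  have "list_order xs \<subseteq> set xs \<times> set xs"
    by (auto simp: list_order_def)
  moreover have "refl_on (set xs) (list_order xs)"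
    by (auto simp: refl_on_def iff in_set_conv_nth) blast
  moreover have "trans (list_order xs)"
    by (rule transI) (auto simp: iff, metis assms le_trans le_less_trans nth_eq_iff_index_eq)
  moreover have "antisym (list_order xs)"
    by (rule antisymI) (auto simp: iff, metis assms le_antisym le_less_trans nth_eq_iff_index_eq)
  moreover have "total_on (set xs) (list_order xs)"
    by (auto simp: total_on_def iff in_set_conv_nth) (metis nat_le_linear)
  ultimately show ?thesis
    by (simp add: order_on_defs)
qed

lemma list_order_append:
  assumes "x \<in> set xs" "y \<in> set ys"
  shows "(x, y) \<in> list_order (xs @ ys)"
proof -
  from assms obtain i j where ij: "i < length xs" "xs ! i = x" "j < length ys" "ys ! j = y"
    by (metis in_set_conv_nth)
  show ?thesis
    unfolding list_order_def
    by (rule CollectI, rule exI[of _ i], rule exI[of _ "length xs + j"])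
      (use ij in \<open>simp add: nth_append\<close>)
qed

section \<open>Encoded instances and their sizes\<close>

lemma encodes_instance:
  assumes "encodes ms qs rs M Q R"
  shows "oba_instance (length ms) qs rs"
  using assms by unfold_locales (auto simp: encodes_def Let_def)

text \<open>Zeroed memory already represents the empty graph: null list heads, zero counters, no
  edges.\<close>

lemma input_initial_state:
  assumes "oba_instance (length ms) qs rs"
  shows "oba_instance.input (length ms) qs rs (initial_state ms qs rs)"
    and "oba_instance.graph (length ms) 0 [] (reg (initial_state ms qs rs) rEdges)
      (arr (initial_state ms qs rs) aDst) (arr (initial_state ms qs rs) aHead)
      (arr (initial_state ms qs rs) aNext) (arr (initial_state ms qs rs) aCount)"
proof -
  interpret oba_instance "length ms" qs rs by fact
  show "input (initial_state ms qs rs)"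
    by (auto simp: input_def initial_state_def array_of_def offset_def nth_append less_Suc_eq_le
        simp del: upt_Suc)
  show "graph_in 0 [] (initial_state ms qs rs)"
    by (simp add: graph_def initial_state_def adjacency_def start_nodes_def indegree_def
        settled_def)
qed

text \<open>Distinctness of the sets named makes pairs of indices correspond to pairs of sets. In
  the last bound each nonempty set pays for itself, and the 1 is for the empty set.\<close>

lemma encodes_sizes:
  assumes enc: "encodes ms qs rs M Q R"
  shows "length ms = card M" "length rs = card R" "length (concat qs) = (\<Sum>A\<in>Q. card A)"
    "length qs \<le> (\<Sum>A\<in>Q. card A) + 1"
proof -
  define S where "S = map (\<lambda>q. (!) ms ` set q) qs"
  have ms: "distinct ms" "set ms = M"
    and q: "\<And>q. q \<in> set qs \<Longrightarrow> distinct q \<and> set q \<subseteq> {..<length ms}"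
    and S: "distinct S" "set S = Q"
    and rs: "distinct rs" "set rs \<subseteq> {..<length qs} \<times> {..<length qs}"
      "(\<lambda>(i, j). (S ! i, S ! j)) ` set rs = R"
    using enc by (auto simp: encodes_def Let_def S_def)
  show "length ms = card M" using ms distinct_card by fastforce
  have "inj_on (\<lambda>(i, j). (S ! i, S ! j)) (set rs)"
  proof (rule inj_onI)
    fix p p' assume "p \<in> set rs" "p' \<in> set rs"
      and eq: "(\<lambda>(i, j). (S ! i, S ! j)) p = (\<lambda>(i, j). (S ! i, S ! j)) p'"
    then have "p \<in> {..<length S} \<times> {..<length S}" "p' \<in> {..<length S} \<times> {..<length S}"
      using rs(2) by (auto simp: S_def)
    then show "p = p'"
      using eq S(1) by (auto simp: nth_eq_iff_index_eq)
  qed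
  then show "length rs = card R"
    using rs card_image distinct_card by metis
  have "card ((!) ms ` set q) = length q" if "q \<in> set qs" for q
  proof -
    have "inj_on ((!) ms) (set q)"
      using q[OF that] ms(1) by (meson inj_on_nth lessThan_iff subsetD)
    then show ?thesis using q[OF that] by (simp add: card_image distinct_card)
  qed
  then have "map card S = map length qs" by (simp add: S_def)
  moreover have "(\<Sum>A\<in>Q. card A) = sum_list (map card S)"
    using S sum.distinct_set_conv_list by metis
  ultimately show len: "length (concat qs) = (\<Sum>A\<in>Q. card A)"
    by (simp add: length_concat)
  have fin: "finite Q" "\<And>A. A \<in> Q \<Longrightarrow> finite A"
    using S by (auto simp: S_def)
  have "length qs = card Q" using S distinct_card[OF S(1)] by (simp add: S_def)
  also have "\<dots> \<le> card (Q - {{}}) + 1"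
    unfolding card_Diff_singleton_if by (cases "{} \<in> Q") simp_all
  also have "card (Q - {{}}) = (\<Sum>A\<in>Q - {{}}. 1)" by simp
  also have "\<dots> \<le> (\<Sum>A\<in>Q - {{}}. card A)"
    by (rule sum_mono) (use fin in \<open>auto simp: Suc_le_eq card_gt_0_iff\<close>)
  also have "\<dots> \<le> (\<Sum>A\<in>Q. card A)"
    using fin(1) by (intro sum_mono2) auto
  finally show "length qs \<le> (\<Sum>A\<in>Q. card A) + 1" by simp
qed

text \<open>Closedness of \<open>q\<close> gives completeness, its justification gives soundness;
  the verdict tells whether all elements are in \<open>q\<close>.\<close>

lemma solved_correct:
  assumes enc: "encodes ms qs rs M Q R"
    and solved: "oba_instance.solved (length ms) qs rs q s"
    and verdict: "reg s rVerdict = (if length (filter (\<lambda>v. v < length ms) q) < length ms then 0 else 1)"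
  shows "if \<exists>\<sigma>. linear_order_on M \<sigma> \<and> one_before_all Q R \<sigma>
    then \<exists>\<sigma>. returns_order ms s \<sigma> \<and> linear_order_on M \<sigma> \<and> one_before_all Q R \<sigma>
    else reports_none s"
proof -
  interpret oba_instance "length ms" qs rs
    using enc by (rule encodes_instance)
  define n where "n = length ms"
  define S where "S = map (\<lambda>q. (!) ms ` set q) qs"
  have ms: "distinct ms" "set ms = M"
    and S: "set S = Q"
    and R: "(\<lambda>(i, j). (S ! i, S ! j)) ` set rs = R"
    using enc by (auto simp: encodes_def Let_def S_def)
  have S_nth: "S ! i = (!) ms ` set (qs ! i)" if "i < length qs" for i
    using that by (simp add: S_def)
  have q: "distinct q" "justified edges threshold q"
    and set_q: "set q = {v. v < nodes \<and> threshold v \<le> settled edges (out_edges edges (set q)) v}"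
    using solved by (auto simp: solved_def propagating_def)
  define xs where "xs = filter (\<lambda>v. v < n) q"
  have xs: "distinct xs" "set xs \<subseteq> {..<n}" "set xs = set q \<inter> {..<n}"
    using q(1) by (auto simp: xs_def)
  have out: "arr s aOut i = xs ! i" if "i < length xs" for i
    using solved that by (simp add: solved_def stores_def xs_def n_def)
  have full_iff: "length xs < n \<longleftrightarrow> \<not> {..<n} \<subseteq> set q"
  proof -
    have len: "length xs = card (set xs)" using xs(1) by (simp add: distinct_card)
    show ?thesis
    proof (cases "{..<n} \<subseteq> set q")
      case True
      then have "set xs = {..<n}" unfolding xs(3) by blast
      then show ?thesis using True len by simp
    next
      case False
      then have "set xs \<subset> {..<n}" unfolding xs(3) by blast
      then have "card (set xs) < card {..<n}" by (rule psubset_card_mono[rotated]) simp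
      then show ?thesis using False len by simp
    qed
  qed
  have complete: "{..<n} \<subseteq> set q" if lin: "linear_order_on M \<sigma>" and oba: "one_before_all Q R \<sigma>" for \<sigma>
  proof -
    \<comment> \<open>The strict order is pulled back along \<open>ms\<close> to indices.\<close>
    define prec where "prec = (\<lambda>x y. (ms ! x, ms ! y) \<in> \<sigma> \<and> ms ! x \<noteq> ms ! y)"
    have po: "partial_order_on M \<sigma>" using lin by (simp add: linear_order_on_def)
    then have "\<sigma> \<subseteq> M \<times> M" by (rule partial_order_onD)
    then have "finite \<sigma>" by (rule finite_subset) (simp flip: ms(2))
    \<comment> \<open>Finiteness makes the strict order well-founded, which supplies the minimal
      elements demanded by \<open>closed_complete\<close>.\<close>
    then have wf: "wf (\<sigma> - Id)" using po by (rule partial_order_on_well_order_on)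
    show ?thesis
      unfolding n_def
    proof (rule closed_complete[where prec = prec])
      show "v \<in> set q" if "v < nodes" "threshold v \<le> settled edges (out_edges edges (set q)) v" for v
        using that set_q by blast
      show "\<exists>u\<in>U. \<forall>x\<in>U. \<not> prec x u" if U: "U \<subseteq> {..<length ms}" "U \<noteq> {}" for U
      proof -
        from U(2) obtain z where "z \<in> (!) ms ` U"
          and "\<And>y. (y, z) \<in> \<sigma> - Id \<Longrightarrow> y \<notin> (!) ms ` U"
          using wfE_min[OF wf, of _ "(!) ms ` U"] by (metis ex_in_conv imageI)
        then show ?thesis by (auto simp: prec_def)
      qed
      show "\<exists>x\<in>set (qs ! i). \<forall>y\<in>set (qs ! j). prec x y"
        if ij: "(i, j) \<in> set rs" and ne: "qs ! j \<noteq> []" for i j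
      proof -
        have i: "i < length qs" and j: "j < length qs" using ij pairs by auto
        have "(S ! i, S ! j) \<in> R" using ij R by (auto simp: image_iff intro!: bexI[of _ "(i, j)"])
        moreover have "S ! i \<in> Q" "S ! j \<in> Q"
          using i j S by (auto simp: S_def)
        moreover have "S ! j \<noteq> {}" using ne j by (simp add: S_nth)
        ultimately obtain a where "a \<in> S ! i" "\<And>b. b \<in> S ! j \<Longrightarrow> (a, b) \<in> \<sigma> \<and> a \<noteq> b"
          using oba unfolding one_before_all_def by blast
        then show ?thesis
          unfolding S_nth[OF i] S_nth[OF j] prec_def by auto
      qed
    qed
  qed
  define \<sigma> where "\<sigma> = list_order (map ((!) ms) xs)"
  have sound: "returns_order ms s \<sigma> \<and> linear_order_on M \<sigma> \<and> one_before_all Q R \<sigma>"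
    if full: "{..<n} \<subseteq> set q"
  proof (intro conjI)
    have set_xs: "set xs = {..<n}" using full xs(3) by blast
    have len: "length xs = n"
      using distinct_card[OF xs(1)] unfolding set_xs by simp
    have "bij_betw ((!) xs) {..<n} {..<n}"
      using bij_betw_nth[OF xs(1)] len set_xs by metis
    then have bij: "bij_betw (arr s aOut) {..<n} {..<n}"
      using bij_betw_cong[of "{..<n}" "arr s aOut" "(!) xs"] out len by auto
    have "(x, y) \<in> \<sigma> \<longleftrightarrow>
        (\<exists>i j. i \<le> j \<and> j < n \<and> x = ms ! arr s aOut i \<and> y = ms ! arr s aOut j)" for x y
    proof -
      have "map ((!) ms) xs ! i = ms ! arr s aOut i" if "i < n" for i
        using that by (simp add: out len)
      then show ?thesis
        unfolding \<sigma>_def list_order_def length_map len mem_Collect_eq prod.inject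
        by (metis le_less_trans)
    qed
    then have "\<sigma> = {(ms ! arr s aOut i, ms ! arr s aOut j) | i j. i \<le> j \<and> j < length ms}"
      unfolding n_def[symmetric] by fast
    moreover have "reg s rVerdict = 1"
      using verdict full full_iff by (simp add: xs_def n_def)
    ultimately show "returns_order ms s \<sigma>"
      using bij by (simp add: returns_order_def n_def)
    have "set (map ((!) ms) xs) = M"
      unfolding set_map set_xs n_def ms(2)[symmetric] by (auto simp: set_conv_nth)
    moreover have "distinct (map ((!) ms) xs)"
      using xs(1) ms(1) set_xs by (auto simp: distinct_map n_def intro!: inj_on_nth)
    ultimately show "linear_order_on M \<sigma>"
      unfolding \<sigma>_def using linear_order_on_list_order by metis
    show "one_before_all Q R \<sigma>"
      unfolding one_before_all_def
    proof (intro ballI impI, elim conjE)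
      fix A B assume "(A, B) \<in> R" "B \<noteq> {}"
      then obtain i j where ij: "(i, j) \<in> set rs" "S ! i = A" "S ! j = B"
        using R by auto
      have i: "i < length qs" and j: "j < length qs" using ij pairs by auto
      have less: "z < n" if "z \<in> set (qs ! i) \<or> z \<in> set (qs ! j)" for z
        using that member_less i j by (auto simp: n_def)
      have "\<exists>z\<in>set q. z \<in> set (qs ! j)"
      proof -
        obtain z where "z \<in> set (qs ! j)"
          using \<open>B \<noteq> {}\<close> ij(3) unfolding S_nth[OF j] by blast
        then show ?thesis using full less by blast
      qed
      \<comment> \<open>\<open>y\<close> is the first member of the \<open>j\<close>-th set in the
        queue, so whatever precedes \<open>y\<close> precedes that whole set.\<close>
      from this obtain us y vs where split: "q = us @ y # vs" and y: "y \<in> set (qs ! j)"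
        and first: "\<And>z. z \<in> set us \<Longrightarrow> z \<notin> set (qs ! j)"
        using split_list_first_prop[of q "\<lambda>z. z \<in> set (qs ! j)"] by blast
      obtain x where x: "x \<in> set (qs ! i)" "x \<in> set us"
        using justified_sound[OF q(2) split y ij(1)] by blast
      have "(ms ! x, ms ! z) \<in> \<sigma> \<and> ms ! x \<noteq> ms ! z" if z: "z \<in> set (qs ! j)" for z
      proof
        have "z \<in> set (y # vs)" using z less full first split by auto
        then show "(ms ! x, ms ! z) \<in> \<sigma>"
          unfolding \<sigma>_def xs_def split filter_append map_append
          using x z less by (intro list_order_append) auto
        \<comment> \<open>\<open>x\<close> lies in \<open>us\<close>, where no member of the
          \<open>j\<close>-th set occurs, so \<open>x\<close> differs from \<open>z\<close> even if
          the two sets overlap.\<close>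
        show "ms ! x \<noteq> ms ! z"
          using less[of x] less[of z] x z first ms(1) by (auto simp: n_def nth_eq_iff_index_eq)
      qed
      then show "\<exists>x\<in>A. \<forall>y\<in>B. (x, y) \<in> \<sigma> \<and> x \<noteq> y"
        using x(1) ij(2,3) unfolding S_nth[OF i] S_nth[OF j] by blast
    qed
  qed
  show ?thesis
  proof (cases "{..<n} \<subseteq> set q")
    case True
    then show ?thesis using sound by auto
  next
    case False
    then have "reports_none s"
      using verdict full_iff by (simp add: reports_none_def xs_def n_def)
    then show ?thesis using complete False by auto
  qed
qed

text \<open>\<open>p\<close> and \<open>T\<close> are chosen before the instance: one program and
  one bound serve all instances and all encodings.\<close>

theorem theorem2:
  shows "\<exists>(p :: com) (T :: nat \<Rightarrow> nat).
    (\<lambda>N. real (T N)) \<in> O(\<lambda>N. real N) \<and>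
    (\<forall>(M :: 'a set) Q R ms qs rs.
      finite M \<and> Q \<subseteq> Pow M \<and> R \<subseteq> Q \<times> Q \<and> encodes ms qs rs M Q R \<longrightarrow>
      (\<exists>t s. exec p (initial_state ms qs rs) t s \<and>
        t \<le> T (card M + card R + (\<Sum>A\<in>Q. card A)) \<and>
        (if \<exists>\<sigma>. linear_order_on M \<sigma> \<and> one_before_all Q R \<sigma>
         then \<exists>\<sigma>. returns_order ms s \<sigma> \<and> linear_order_on M \<sigma> \<and> one_before_all Q R \<sigma>
         else reports_none s)))"
proof (intro exI[of _ find_order] exI[of _ "\<lambda>N. 75 * N + 54"] conjI allI impI)
  show "(\<lambda>N. real (75 * N + 54)) \<in> O(\<lambda>N. real N)"
  \<comment> \<open>The factor is 129 = 75 + 54, valid from \<open>N = 1\<close> on.\<close>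
  proof (rule bigoI)
    show "\<forall>\<^sub>F N in at_top. norm (real (75 * N + 54)) \<le> 129 * norm (real N)"
      unfolding eventually_at_top_linorder by (intro exI[of _ 1]) auto
  qed
next
  fix M :: "'a set" and Q R ms qs rs
  assume "finite M \<and> Q \<subseteq> Pow M \<and> R \<subseteq> Q \<times> Q \<and> encodes ms qs rs M Q R"
  then have enc: "encodes ms qs rs M Q R" by blast
  interpret oba_instance "length ms" qs rs
    using enc by (rule encodes_instance)
  note sizes = encodes_sizes[OF enc]
  obtain t s q where ex: "exec find_order (initial_state ms qs rs) t s"
    and q: "solved q s"
      "reg s rVerdict = (if length (filter (\<lambda>v. v < length ms) q) < length ms then 0 else 1)"
    and t: "t \<le> 14 * length ms + 39 * length qs + 36 * length (concat qs) + 25 * length rs + 15"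
    using wp_find_order[OF input_initial_state[OF oba_instance_axioms]] unfolding wp_def by blast
  \<comment> \<open>Since \<open>length qs\<close> is at most the sum of the cardinalities plus 1,
    that sum gets the coefficient 39 + 36 = 75, the largest one, and the constant becomes 39 + 15 =
    54.\<close>
  have "t \<le> 75 * (card M + card R + (\<Sum>A\<in>Q. card A)) + 54"
    using t sizes(4) unfolding sizes(1-3) by (simp add: algebra_simps)
  with ex solved_correct[OF enc q]
  show "\<exists>t s. exec find_order (initial_state ms qs rs) t s \<and>
        t \<le> 75 * (card M + card R + (\<Sum>A\<in>Q. card A)) + 54 \<and>
        (if \<exists>\<sigma>. linear_order_on M \<sigma> \<and> one_before_all Q R \<sigma>
         then \<exists>\<sigma>. returns_order ms s \<sigma> \<and> linear_order_on M \<sigma> \<and> one_before_all Q R \<sigma>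
         else reports_none s)"
    by blast
qed

end
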